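(* Let $(\mathscr{A},\delta)$ be a discrete quantum group with $\mathscr{A}$ infinite dimensional. Then $(M(\mathscr{A}),\delta)$, where $\delta$ is extended to $M(\mathscr{A})\to M(\mathscr{A}\otimes\mathscr{A})$, is not a Hopf algebra.
   Context: All algebras are over $\mathbb{C}$; $\otimes$ is the algebraic tensor product. For an algebra $\mathscr{A}$ with non degenerate product, $M(\mathscr{A})$ is its multiplier algebra (pairs of linear maps $a\mapsto ma$, $a\mapsto am$ on $\mathscr{A}$ with $(bm)a=b(ma)$). A homomorphism $\Phi:\mathscr{A}\to M(\mathscr{B})$ is non degenerate if $\Phi(\mathscr{A})\mathscr{B}=\mathscr{B}\Phi(\mathscr{A})=\mathscr{B}$ (linear spans of products); it then extends uniquely to a unital homomorphism $M(\mathscr{A})\to M(\mathscr{B})$, denoted by the same symbol. A multiplier Hopf algebra is a pair $(\mathscr{A},\delta)$ of an algebra $\mathscr{A}$ with non degenerate product and a homomorphism $\delta:\mathscr{A}\to M(\mathscr{A}\otimes\mathscr{A})$ such that the maps $T_1(a\otimes b)=\delta(a)(I\otimes b)$ and $T_2(a\otimes b)=(a\otimes I)\delta(b)$ are bijections of $\mathscr{A}\otimes\mathscr{A}$ onto $\mathscr{A}\otimes\mathscr{A}$, and $T_2\otimes\mathrm{id}$ and $\mathrm{id}\otimes T_1$ commute on $\mathscr{A}\otimes\mathscr{A}\otimes\mathscr{A}$. Then $\delta$ is non degenerate. It is a multiplier Hopf $*$-algebra if $\mathscr{A}$ is a $*$-algebra and $\delta$ is a $*$-homomorphism. A discrete quantum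 group is a multiplier Hopf $*$-algebra $(\mathscr{A},\delta)$ such that $\mathscr{A}$ is a direct sum of full matrix algebras. $M(\mathscr{A})\otimes M(\mathscr{A})$ is regarded as a subalgebra of $M(\mathscr{A}\otimes\mathscr{A})$; for $(M(\mathscr{A}),\delta)$ to be a Hopf algebra means that $\delta$ maps $M(\mathscr{A})$ into the algebraic tensor product $M(\mathscr{A})\otimes M(\mathscr{A})$ and makes the unital algebra $M(\mathscr{A})$ a Hopf algebra in the usual sense. *)

theory Defs
  imports Complex_Main "HOL-Library.Poly_Mapping" "HOL-Library.FuncSet"
    "Jordan_Normal_Form.Matrix"
begin

section \<open>Complex vector spaces, algebras and \<open>*\<close>-algebras\<close>

class complex_vector = ab_group_add +
  fixes scaleC :: "complex \<Rightarrow> 'a \<Rightarrow> 'a" (infixr "*\<^sub>C" 75)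
  assumes scaleC_add_right: "c *\<^sub>C (x + y) = c *\<^sub>C x + c *\<^sub>C y"
    and scaleC_add_left: "(c + d) *\<^sub>C x = c *\<^sub>C x + d *\<^sub>C x"
    and scaleC_scaleC: "c *\<^sub>C d *\<^sub>C x = (c * d) *\<^sub>C x"
    and scaleC_one: "1 *\<^sub>C x = x"

global_interpretation cvs: vector_space "scaleC :: complex \<Rightarrow> 'a \<Rightarrow> 'a::complex_vector"
  by unfold_locales (auto simp: scaleC_add_right scaleC_add_left scaleC_scaleC scaleC_one)

abbreviation clinear :: "('a::complex_vector \<Rightarrow> 'b::complex_vector) \<Rightarrow> bool" where
  "clinear \<equiv> Vector_Spaces.linear scaleC scaleC"

definition cbilinear ::
    "('a::complex_vector \<Rightarrow> 'b::complex_vector \<Rightarrow> 'c::complex_vector) \<Rightarrow> bool" where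
  "cbilinear f \<longleftrightarrow> (\<forall>x. clinear (f x)) \<and> (\<forall>y. clinear (\<lambda>x. f x y))"

definition finite_dimensional :: "'a::complex_vector itself \<Rightarrow> bool" where
  "finite_dimensional (_ :: 'a itself) \<longleftrightarrow> (\<exists>B :: 'a set. finite B \<and> cvs.span B = UNIV)"

lemma clinear_iff:
  "clinear f \<longleftrightarrow> (\<forall>x y. f (x + y) = f x + f y) \<and> (\<forall>c x. f (c *\<^sub>C x) = c *\<^sub>C f x)"
proof
  assume "clinear f"
  then interpret Vector_Spaces.linear scaleC scaleC f .
  show "(\<forall>x y. f (x + y) = f x + f y) \<and> (\<forall>c x. f (c *\<^sub>C x) = c *\<^sub>C f x)"
    by (simp add: add scale)
next
  assume "(\<forall>x y. f (x + y) = f x + f y) \<and> (\<forall>c x. f (c *\<^sub>C x) = c *\<^sub>C f x)"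
  then show "clinear f" by unfold_locales auto
qed

text \<open>Algebras are associative, not necessarily unital.\<close>

class complex_algebra = complex_vector + ring +
  assumes mult_scaleC_left: "(c *\<^sub>C x) * y = c *\<^sub>C (x * y)"
    and mult_scaleC_right: "x * (c *\<^sub>C y) = c *\<^sub>C (x * y)"

class complex_star_algebra = complex_algebra +
  fixes star :: "'a \<Rightarrow> 'a"
  assumes star_add: "star (x + y) = star x + star y"
    and star_scaleC: "star (c *\<^sub>C x) = cnj c *\<^sub>C star x"
    and star_mult: "star (x * y) = star y * star x"
    and star_star: "star (star x) = x"

text \<open>A unital algebra is an algebra of class \<^class>\<open>monoid_mult\<close>; the class \<^class>\<open>ring_1\<close>
  would exclude the multiplier algebra of the zero algebra.\<close>

definition algebra_hom :: "('a::complex_algebra \<Rightarrow> 'b::complex_algebra) \<Rightarrow> bool" where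
  "algebra_hom f \<longleftrightarrow> clinear f \<and> (\<forall>x y. f (x * y) = f x * f y)"

definition unital_algebra_hom ::
    "('a::{complex_algebra,monoid_mult} \<Rightarrow> 'b::{complex_algebra,monoid_mult}) \<Rightarrow> bool" where
  "unital_algebra_hom f \<longleftrightarrow> algebra_hom f \<and> f 1 = 1"

definition nondegenerate_product :: "'a::complex_algebra itself \<Rightarrow> bool" where
  "nondegenerate_product (_ :: 'a itself) \<longleftrightarrow>
     (\<forall>a::'a. (\<forall>b. a * b = 0) \<longrightarrow> a = 0) \<and> (\<forall>a::'a. (\<forall>b. b * a = 0) \<longrightarrow> a = 0)"

instantiation complex :: complex_algebra
begin
definition scaleC_complex :: "complex \<Rightarrow> complex \<Rightarrow> complex" where
  "scaleC_complex c x = c * x"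
instance by standard (auto simp: scaleC_complex_def algebra_simps)
end

instantiation poly_mapping :: (type, complex_vector) complex_vector
begin
lift_definition scaleC_poly_mapping :: "complex \<Rightarrow> ('a \<Rightarrow>\<^sub>0 'b) \<Rightarrow> ('a \<Rightarrow>\<^sub>0 'b)"
  is "\<lambda>c f k. c *\<^sub>C f k"
  by (rule finite_subset[rotated]) auto
instance
  by standard (transfer; auto simp: scaleC_add_right scaleC_add_left scaleC_scaleC scaleC_one)+
end


section \<open>The algebraic tensor product\<close>

text \<open>The quotient of the free vector space on \<open>'a \<times> 'b\<close> by the span of the bilinearity relations.\<close>

abbreviation free_pair :: "'a \<Rightarrow> 'b \<Rightarrow> ('a \<times> 'b) \<Rightarrow>\<^sub>0 complex" where
  "free_pair x y \<equiv> Poly_Mapping.single (x, y) 1"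

definition tensor_relators :: "(('a::complex_vector \<times> 'b::complex_vector) \<Rightarrow>\<^sub>0 complex) set" where
  "tensor_relators =
     {free_pair (x + x') y - free_pair x y - free_pair x' y | x x' y. True} \<union>
     {free_pair x (y + y') - free_pair x y - free_pair x y' | x y y'. True} \<union>
     {free_pair (c *\<^sub>C x) y - c *\<^sub>C free_pair x y | c x y. True} \<union>
     {free_pair x (c *\<^sub>C y) - c *\<^sub>C free_pair x y | c x y. True}"

definition tensor_rel ::
    "(('a::complex_vector \<times> 'b::complex_vector) \<Rightarrow>\<^sub>0 complex) \<Rightarrow> (('a \<times> 'b) \<Rightarrow>\<^sub>0 complex) \<Rightarrow> bool" where
  "tensor_rel f g \<longleftrightarrow> f - g \<in> cvs.span tensor_relators"

lemma equivp_tensor_rel: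
  "equivp (tensor_rel :: (('a::complex_vector \<times> 'b::complex_vector) \<Rightarrow>\<^sub>0 complex) \<Rightarrow> _)"
  (is "equivp ?R")
proof (rule equivpI)
  show "reflp ?R" by (auto simp: reflp_def tensor_rel_def cvs.span_zero)
  show "symp ?R"
    unfolding symp_def tensor_rel_def by (metis cvs.span_neg minus_diff_eq)
  show "transp ?R"
  proof (rule transpI)
    fix f g h
    assume "?R f g" "?R g h"
    then have "(f - g) + (g - h) \<in> cvs.span tensor_relators"
      unfolding tensor_rel_def by (rule cvs.span_add)
    then show "?R f h" by (simp add: tensor_rel_def)
  qed
qed

quotient_type (overloaded) ('a, 'b) tensor =
  "('a::complex_vector \<times> 'b::complex_vector) \<Rightarrow>\<^sub>0 complex" / tensor_rel
  by (rule equivp_tensor_rel)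

instantiation tensor :: (complex_vector, complex_vector) complex_vector
begin
lift_definition zero_tensor :: "('a, 'b) tensor" is 0 .
lift_definition plus_tensor :: "('a, 'b) tensor \<Rightarrow> ('a, 'b) tensor \<Rightarrow> ('a, 'b) tensor" is "(+)"
  unfolding tensor_rel_def by (metis cvs.span_add add_diff_add)
lift_definition uminus_tensor :: "('a, 'b) tensor \<Rightarrow> ('a, 'b) tensor" is uminus
  unfolding tensor_rel_def by (metis cvs.span_neg minus_diff_minus)
lift_definition minus_tensor :: "('a, 'b) tensor \<Rightarrow> ('a, 'b) tensor \<Rightarrow> ('a, 'b) tensor" is "(-)"
  unfolding tensor_rel_def 
proof -
  fix f f' g g' :: "('a \<times> 'b) \<Rightarrow>\<^sub>0 complex"
  assume "f - f' \<in> cvs.span tensor_relators" "g - g' \<in> cvs.span tensor_relators"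
  then have "(f - f') - (g - g') \<in> cvs.span tensor_relators" by (rule cvs.span_diff)
  then show "f - g - (f' - g') \<in> cvs.span tensor_relators" by (simp add: algebra_simps)
qed
lift_definition scaleC_tensor :: "complex \<Rightarrow> ('a, 'b) tensor \<Rightarrow> ('a, 'b) tensor" is scaleC
  unfolding tensor_rel_def by (metis cvs.span_scale cvs.scale_right_diff_distrib)
instance
proof
  fix a b c :: "('a, 'b) tensor" and s t :: complex
  note refl' = equivp_reflp[OF equivp_tensor_rel]
  show "a + b + c = a + (b + c)" by transfer (simp add: add.assoc refl')
  show "a + b = b + a" by transfer (simp add: add.commute refl')
  show "0 + a = a" by transfer (simp add: refl')
  show "- a + a = 0" by transfer (simp add: refl')
  show "a - b = a + - b" by transfer (simp add: refl')
  show "s *\<^sub>C (a + b) = s *\<^sub>C a + s *\<^sub>C b" by transfer (simp add: scaleC_add_right refl')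
  show "(s + t) *\<^sub>C a = s *\<^sub>C a + t *\<^sub>C a" by transfer (simp add: scaleC_add_left refl')
  show "s *\<^sub>C t *\<^sub>C a = (s * t) *\<^sub>C a" by transfer (simp add: scaleC_scaleC refl')
  show "1 *\<^sub>C a = a" by transfer (simp add: scaleC_one refl')
qed
end

lift_definition tens :: "'a::complex_vector \<Rightarrow> 'b::complex_vector \<Rightarrow> ('a, 'b) tensor"
  (infixr "\<otimes>\<^sub>t" 72) is free_pair .

lemma tens_rules:
  "(x + x') \<otimes>\<^sub>t y = x \<otimes>\<^sub>t y + x' \<otimes>\<^sub>t y"
  "x \<otimes>\<^sub>t (y + y') = x \<otimes>\<^sub>t y + x \<otimes>\<^sub>t y'"
  "(c *\<^sub>C x) \<otimes>\<^sub>t y = c *\<^sub>C (x \<otimes>\<^sub>t y)"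
  "x \<otimes>\<^sub>t (c *\<^sub>C y) = c *\<^sub>C (x \<otimes>\<^sub>t y)"
  by (transfer; unfold tensor_rel_def diff_diff_eq[symmetric]; rule cvs.span_base;
      unfold tensor_relators_def; blast)+

lemma cbilinear_tens: "cbilinear (\<otimes>\<^sub>t)"
  by (simp add: cbilinear_def clinear_iff tens_rules)

lemma free_induct:
  fixes f :: "'k \<Rightarrow>\<^sub>0 complex"
  assumes zero: "P 0" and step: "\<And>c k f. P f \<Longrightarrow> P (c *\<^sub>C Poly_Mapping.single k 1 + f)"
  shows "P f"
proof (induction f rule: update_induct)
  case const
  then show ?case by (rule zero)
next
  case (update f a b)
  have "Poly_Mapping.update a b f = b *\<^sub>C Poly_Mapping.single a 1 + f"
    using update(1)
    by (intro poly_mapping_eqI)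
       (auto simp: lookup_add lookup_update scaleC_poly_mapping.rep_eq lookup_single
          scaleC_complex_def when_def in_keys_iff)
  then show ?case using step[OF update(3)] by simp
qed

lemma abs_tensor_rep: "abs_tensor (rep_tensor x) = x"
  by (rule Quotient_abs_rep[OF Quotient_tensor])

lemma tensor_induct [case_names tens add]:
  assumes tens: "\<And>a b. P (a \<otimes>\<^sub>t b)" and add: "\<And>x y. P x \<Longrightarrow> P y \<Longrightarrow> P (x + y)"
  shows "P x"
proof -
  have "P (abs_tensor f)" for f
  proof (induction f rule: free_induct)
    case 1
    have "(0::('a,'b) tensor) = 0 \<otimes>\<^sub>t 0"
      using tens_rules(1)[of 0 0 0] by simp
    then show ?case using tens by (metis zero_tensor.abs_eq)
  next
    case (2 c k f)
    obtain a b where k: "k = (a, b)" by (cases k)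
    have "abs_tensor (c *\<^sub>C Poly_Mapping.single k 1 + f) = (c *\<^sub>C a) \<otimes>\<^sub>t b + abs_tensor f"
      unfolding k tens_rules by (simp add: tens.abs_eq scaleC_tensor.abs_eq plus_tensor.abs_eq)
    then show ?case using add[OF tens 2] by simp
  qed
  from this[of "rep_tensor x"] show ?thesis by (simp add: abs_tensor_rep)
qed

text \<open>The universal property, for maps that are semilinear with respect to \<open>\<sigma>\<close>; it is needed for the
  identity and for complex conjugation.\<close>

lemma tensor_universal:
  fixes \<beta> :: "'a::complex_vector \<Rightarrow> 'b::complex_vector \<Rightarrow> 'c::complex_vector"
  assumes \<sigma>: "\<And>c d. \<sigma> (c + d) = \<sigma> c + \<sigma> d" "\<And>c d. \<sigma> (c * d) = \<sigma> c * \<sigma> d" "\<sigma> 1 = 1"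
    and \<beta>: "\<And>x x' y. \<beta> (x + x') y = \<beta> x y + \<beta> x' y" "\<And>x y y'. \<beta> x (y + y') = \<beta> x y + \<beta> x y'"
      "\<And>c x y. \<beta> (c *\<^sub>C x) y = \<sigma> c *\<^sub>C \<beta> x y" "\<And>c x y. \<beta> x (c *\<^sub>C y) = \<sigma> c *\<^sub>C \<beta> x y"
  shows "\<exists>!F. (\<forall>x y. F (x + y) = F x + F y) \<and> (\<forall>c x. F (c *\<^sub>C x) = \<sigma> c *\<^sub>C F x) \<and>
           (\<forall>a b. F (a \<otimes>\<^sub>t b) = \<beta> a b)"
proof (rule ex_ex1I)
  have \<sigma>0: "\<sigma> 0 = 0" using \<sigma>(1)[of 0 0] by simp
  define G where "G f = (\<Sum>k\<in>Poly_Mapping.keys f. \<sigma> (Poly_Mapping.lookup f k) *\<^sub>C \<beta> (fst k) (snd k))"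
    for f :: "('a \<times> 'b) \<Rightarrow>\<^sub>0 complex"
  have G_super: "G f = (\<Sum>k\<in>S. \<sigma> (Poly_Mapping.lookup f k) *\<^sub>C \<beta> (fst k) (snd k))"
    if "finite S" "Poly_Mapping.keys f \<subseteq> S" for f S
    unfolding G_def
  proof (rule sum.mono_neutral_left[OF that], rule ballI)
    fix k assume "k \<in> S - Poly_Mapping.keys f"
    then have "Poly_Mapping.lookup f k = 0" by (metis DiffD2 in_keys_iff)
    then show "\<sigma> (Poly_Mapping.lookup f k) *\<^sub>C \<beta> (fst k) (snd k) = 0" by (simp add: \<sigma>0)
  qed
  have G_add: "G (f + g) = G f + G g" for f g
  proof -
    let ?S = "Poly_Mapping.keys f \<union> Poly_Mapping.keys g"
    have k: "Poly_Mapping.keys (f + g) \<subseteq> ?S" by (rule keys_add)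
    show ?thesis
      by (subst G_super[of ?S "f + g"], use k in auto, subst G_super[of ?S f], use k in auto,
          subst G_super[of ?S g], use k in auto)
        (simp add: lookup_add \<sigma>(1) scaleC_add_left sum.distrib)
  qed
  have G_scale: "G (c *\<^sub>C f) = \<sigma> c *\<^sub>C G f" for c f
  proof -
    have k: "Poly_Mapping.keys (c *\<^sub>C f) \<subseteq> Poly_Mapping.keys f"
      by (auto simp: in_keys_iff scaleC_poly_mapping.rep_eq)
    show ?thesis
      by (subst G_super[OF _ k])
         (auto simp: G_def scaleC_poly_mapping.rep_eq scaleC_complex_def \<sigma>(2)
            cvs.scale_sum_right)
  qed
  have G_diff: "G (f - g) = G f - G g" for f g
    using G_add[of "f - g" g] by (simp add: algebra_simps)
  have G_zero: "G 0 = 0" by (simp add: G_def)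
  have G_pair: "G (free_pair x y) = \<beta> x y" for x y
    by (simp add: G_def \<sigma>(3))
  have "cvs.subspace {f. G f = 0}"
    unfolding cvs.subspace_def by (auto simp: G_add G_scale G_zero)
  moreover have "tensor_relators \<subseteq> {f. G f = 0}"
    by (auto simp: tensor_relators_def G_diff G_add G_scale G_pair \<beta>)
  ultimately have "cvs.span tensor_relators \<subseteq> {f. G f = 0}"
    by (intro cvs.span_minimal)
  then have G_rel: "G f = G g" if "tensor_rel f g" for f g
    using that G_diff[of f g] by (auto simp: tensor_rel_def)
  define F where "F x = G (rep_tensor x)" for x
  have F_abs: "F (abs_tensor f) = G f" for f
    unfolding F_def by (rule G_rel) (simp add: tensor.abs_eq_iff[symmetric] abs_tensor_rep)
  have "F (x + y) = F x + F y" for x y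
    by (metis F_abs G_add abs_tensor_rep plus_tensor.abs_eq)
  moreover have "F (c *\<^sub>C x) = \<sigma> c *\<^sub>C F x" for c x
    by (metis F_abs G_scale abs_tensor_rep scaleC_tensor.abs_eq)
  moreover have "F (a \<otimes>\<^sub>t b) = \<beta> a b" for a b
    by (simp add: tens.abs_eq F_abs G_pair)
  ultimately show "\<exists>F. (\<forall>x y. F (x + y) = F x + F y) \<and> (\<forall>c x. F (c *\<^sub>C x) = \<sigma> c *\<^sub>C F x) \<and>
           (\<forall>a b. F (a \<otimes>\<^sub>t b) = \<beta> a b)" by blast
next
  fix F G :: "('a, 'b) tensor \<Rightarrow> 'c"
  assume F: "(\<forall>x y. F (x + y) = F x + F y) \<and> (\<forall>c x. F (c *\<^sub>C x) = \<sigma> c *\<^sub>C F x) \<and>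
           (\<forall>a b. F (a \<otimes>\<^sub>t b) = \<beta> a b)"
    and G: "(\<forall>x y. G (x + y) = G x + G y) \<and> (\<forall>c x. G (c *\<^sub>C x) = \<sigma> c *\<^sub>C G x) \<and>
           (\<forall>a b. G (a \<otimes>\<^sub>t b) = \<beta> a b)"
  show "F = G"
  proof
    fix x show "F x = G x" by (induction x rule: tensor_induct) (use F G in auto)
  qed
qed

text \<open>Only meaningful for bilinear \<open>\<beta>\<close>.\<close>

definition tensor_lift ::
    "('a::complex_vector \<Rightarrow> 'b::complex_vector \<Rightarrow> 'c::complex_vector) \<Rightarrow> ('a, 'b) tensor \<Rightarrow> 'c" where
  "tensor_lift \<beta> = (THE F. clinear F \<and> (\<forall>a b. F (a \<otimes>\<^sub>t b) = \<beta> a b))"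

lemma cbilinear_iff:
  "cbilinear \<beta> \<longleftrightarrow> (\<forall>x x' y. \<beta> (x + x') y = \<beta> x y + \<beta> x' y) \<and>
     (\<forall>x y y'. \<beta> x (y + y') = \<beta> x y + \<beta> x y') \<and>
     (\<forall>c x y. \<beta> (c *\<^sub>C x) y = c *\<^sub>C \<beta> x y) \<and> (\<forall>c x y. \<beta> x (c *\<^sub>C y) = c *\<^sub>C \<beta> x y)"
  unfolding cbilinear_def clinear_iff by blast

lemma tensor_lift_unique:
  assumes "cbilinear \<beta>"
  shows "\<exists>!F. clinear F \<and> (\<forall>a b. F (a \<otimes>\<^sub>t b) = \<beta> a b)"
  using tensor_universal[of "\<lambda>c. c" \<beta>] assms unfolding cbilinear_iff clinear_iff by simp

lemma
  assumes "cbilinear \<beta>"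
  shows clinear_tensor_lift: "clinear (tensor_lift \<beta>)"
    and tensor_lift_tens: "tensor_lift \<beta> (a \<otimes>\<^sub>t b) = \<beta> a b"
  using theI'[OF tensor_lift_unique[OF assms]] unfolding tensor_lift_def by blast+

lemma tensor_lift_rules:
  assumes "cbilinear \<beta>"
  shows "tensor_lift \<beta> (x + y) = tensor_lift \<beta> x + tensor_lift \<beta> y"
    and "tensor_lift \<beta> (c *\<^sub>C x) = c *\<^sub>C tensor_lift \<beta> x"
  using clinear_tensor_lift[OF assms] unfolding clinear_iff by blast+

lemma
  assumes "cbilinear \<beta>" "cbilinear \<gamma>"
  shows tensor_lift_plus:
    "tensor_lift (\<lambda>a b. \<beta> a b + \<gamma> a b) x = tensor_lift \<beta> x + tensor_lift \<gamma> x"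
    and tensor_lift_scaleC: "tensor_lift (\<lambda>a b. k *\<^sub>C \<beta> a b) x = k *\<^sub>C tensor_lift \<beta> x"
proof -
  have p: "cbilinear (\<lambda>a b. \<beta> a b + \<gamma> a b)" and m: "cbilinear (\<lambda>a b. k *\<^sub>C \<beta> a b)"
    using assms by (simp_all add: cbilinear_iff scaleC_add_right scaleC_scaleC mult.commute)
  show "tensor_lift (\<lambda>a b. \<beta> a b + \<gamma> a b) x = tensor_lift \<beta> x + tensor_lift \<gamma> x"
    by (induction x rule: tensor_induct)
       (simp_all add: tensor_lift_tens tensor_lift_rules p assms)
  show "tensor_lift (\<lambda>a b. k *\<^sub>C \<beta> a b) x = k *\<^sub>C tensor_lift \<beta> x"
    by (induction x rule: tensor_induct)
       (simp_all add: tensor_lift_tens tensor_lift_rules m assms scaleC_add_right)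
qed

definition map_tensor ::
    "('a::complex_vector \<Rightarrow> 'c::complex_vector) \<Rightarrow> ('b::complex_vector \<Rightarrow> 'd::complex_vector) \<Rightarrow>
     ('a, 'b) tensor \<Rightarrow> ('c, 'd) tensor" where
  "map_tensor f g = tensor_lift (\<lambda>a b. f a \<otimes>\<^sub>t g b)"

lemma cbilinear_map_tensor:
  "clinear f \<Longrightarrow> clinear g \<Longrightarrow> cbilinear (\<lambda>a b. f a \<otimes>\<^sub>t g b)"
  by (simp add: cbilinear_iff clinear_iff tens_rules)

lemma
  assumes "clinear f" "clinear g"
  shows clinear_map_tensor: "clinear (map_tensor f g)"
    and map_tensor_tens: "map_tensor f g (a \<otimes>\<^sub>t b) = f a \<otimes>\<^sub>t g b"
  unfolding map_tensor_def using cbilinear_map_tensor[OF assms]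
  by (simp_all add: clinear_tensor_lift tensor_lift_tens)

definition tensor_assoc ::
    "(('a::complex_vector, 'b::complex_vector) tensor, 'c::complex_vector) tensor \<Rightarrow>
     ('a, ('b, 'c) tensor) tensor" where
  "tensor_assoc = tensor_lift (\<lambda>x c. tensor_lift (\<lambda>a b. a \<otimes>\<^sub>t (b \<otimes>\<^sub>t c)) x)"

definition tensor_assoc_inv ::
    "('a::complex_vector, ('b::complex_vector, 'c::complex_vector) tensor) tensor \<Rightarrow>
     (('a, 'b) tensor, 'c) tensor" where
  "tensor_assoc_inv = tensor_lift (\<lambda>a y. tensor_lift (\<lambda>b c. (a \<otimes>\<^sub>t b) \<otimes>\<^sub>t c) y)"

lemma tensor_assoc_tens: "tensor_assoc ((a \<otimes>\<^sub>t b) \<otimes>\<^sub>t c) = a \<otimes>\<^sub>t (b \<otimes>\<^sub>t c)"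
proof -
  have b: "cbilinear (\<lambda>a b. a \<otimes>\<^sub>t (b \<otimes>\<^sub>t c))" for c :: 'c
    by (simp add: cbilinear_iff tens_rules)
  have "tensor_lift (\<lambda>a b. a \<otimes>\<^sub>t (b \<otimes>\<^sub>t (c + c'))) x =
          tensor_lift (\<lambda>a b. a \<otimes>\<^sub>t (b \<otimes>\<^sub>t c)) x + tensor_lift (\<lambda>a b. a \<otimes>\<^sub>t (b \<otimes>\<^sub>t c')) x"
      "tensor_lift (\<lambda>a b. a \<otimes>\<^sub>t (b \<otimes>\<^sub>t (k *\<^sub>C c))) x = k *\<^sub>C tensor_lift (\<lambda>a b. a \<otimes>\<^sub>t (b \<otimes>\<^sub>t c)) x"
    for c c' :: 'c and x :: "('a, 'b) tensor" and k
    by (simp_all only: tens_rules tensor_lift_plus[OF b b] tensor_lift_scaleC[OF b b])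
  then have "cbilinear (\<lambda>(x :: ('a, 'b) tensor) (c :: 'c). tensor_lift (\<lambda>a b. a \<otimes>\<^sub>t (b \<otimes>\<^sub>t c)) x)"
    by (simp add: cbilinear_iff tensor_lift_rules[OF b])
  then show ?thesis unfolding tensor_assoc_def by (simp add: tensor_lift_tens b)
qed

lemma tensor_assoc_inv_tens: "tensor_assoc_inv (a \<otimes>\<^sub>t (b \<otimes>\<^sub>t c)) = (a \<otimes>\<^sub>t b) \<otimes>\<^sub>t c"
proof -
  have b: "cbilinear (\<lambda>b c. (a \<otimes>\<^sub>t b) \<otimes>\<^sub>t c)" for a :: 'a
    by (simp add: cbilinear_iff tens_rules)
  have "tensor_lift (\<lambda>b c. ((a + a') \<otimes>\<^sub>t b) \<otimes>\<^sub>t c) x =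
          tensor_lift (\<lambda>b c. (a \<otimes>\<^sub>t b) \<otimes>\<^sub>t c) x + tensor_lift (\<lambda>b c. (a' \<otimes>\<^sub>t b) \<otimes>\<^sub>t c) x"
      "tensor_lift (\<lambda>b c. ((k *\<^sub>C a) \<otimes>\<^sub>t b) \<otimes>\<^sub>t c) x = k *\<^sub>C tensor_lift (\<lambda>b c. (a \<otimes>\<^sub>t b) \<otimes>\<^sub>t c) x"
    for a a' :: 'a and x :: "('b, 'c) tensor" and k
    by (simp_all only: tens_rules tensor_lift_plus[OF b b] tensor_lift_scaleC[OF b b])
  then have "cbilinear (\<lambda>(a :: 'a) (x :: ('b, 'c) tensor). tensor_lift (\<lambda>b c. (a \<otimes>\<^sub>t b) \<otimes>\<^sub>t c) x)"
    by (simp add: cbilinear_iff tensor_lift_rules[OF b])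
  then show ?thesis unfolding tensor_assoc_inv_def by (simp add: tensor_lift_tens b)
qed


section \<open>Tensor products of algebras\<close>

definition tensor_mult ::
    "('a::complex_algebra, 'b::complex_algebra) tensor \<Rightarrow> ('a, 'b) tensor \<Rightarrow> ('a, 'b) tensor" where
  "tensor_mult x y = tensor_lift (\<lambda>a b. tensor_lift (\<lambda>c d. (a * c) \<otimes>\<^sub>t (b * d)) y) x"

lemma
  fixes a c :: "'a::complex_algebra" and b d :: "'b::complex_algebra"
  shows cbilinear_tensor_mult: "cbilinear (tensor_mult :: ('a, 'b) tensor \<Rightarrow> _)"
    and tensor_mult_tens: "tensor_mult (a \<otimes>\<^sub>t b) (c \<otimes>\<^sub>t d) = (a * c) \<otimes>\<^sub>t (b * d)"
proof -
  have b: "cbilinear (\<lambda>c d. (a * c) \<otimes>\<^sub>t (b * d))" for a :: 'a and b :: 'b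
    by (simp add: cbilinear_iff tens_rules distrib_left mult_scaleC_right)
  note bs = tensor_lift_rules[OF b]
  have "tensor_lift (\<lambda>c d. ((a + a') * c) \<otimes>\<^sub>t (b * d)) y =
          tensor_lift (\<lambda>c d. (a * c) \<otimes>\<^sub>t (b * d)) y + tensor_lift (\<lambda>c d. (a' * c) \<otimes>\<^sub>t (b * d)) y"
      "tensor_lift (\<lambda>c d. (a * c) \<otimes>\<^sub>t ((b + b') * d)) y =
          tensor_lift (\<lambda>c d. (a * c) \<otimes>\<^sub>t (b * d)) y + tensor_lift (\<lambda>c d. (a * c) \<otimes>\<^sub>t (b' * d)) y"
      "tensor_lift (\<lambda>c d. ((k *\<^sub>C a) * c) \<otimes>\<^sub>t (b * d)) y =
          k *\<^sub>C tensor_lift (\<lambda>c d. (a * c) \<otimes>\<^sub>t (b * d)) y"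
      "tensor_lift (\<lambda>c d. (a * c) \<otimes>\<^sub>t ((k *\<^sub>C b) * d)) y =
          k *\<^sub>C tensor_lift (\<lambda>c d. (a * c) \<otimes>\<^sub>t (b * d)) y"
    for a a' :: 'a and b b' :: 'b and k y
    by (simp_all only: tens_rules distrib_right mult_scaleC_left tensor_lift_plus[OF b b]
          tensor_lift_scaleC[OF b b])
  then have o: "cbilinear (\<lambda>a b. tensor_lift (\<lambda>c d. (a * c) \<otimes>\<^sub>t (b * d)) y)" for y :: "('a, 'b) tensor"
    by (simp add: cbilinear_iff)
  show "tensor_mult (a \<otimes>\<^sub>t b) (c \<otimes>\<^sub>t d) = (a * c) \<otimes>\<^sub>t (b * d)"
    by (subst tensor_mult_def, subst tensor_lift_tens[OF o], rule tensor_lift_tens[OF b])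
  have "tensor_mult x (y + y') = tensor_mult x y + tensor_mult x y'"
      "tensor_mult x (k *\<^sub>C y) = k *\<^sub>C tensor_mult x y" for x y y' :: "('a, 'b) tensor" and k
    unfolding tensor_mult_def bs by (simp_all only: tensor_lift_plus[OF o o] tensor_lift_scaleC[OF o o])
  then show "cbilinear (tensor_mult :: ('a, 'b) tensor \<Rightarrow> _)"
    by (simp add: cbilinear_iff tensor_mult_def tensor_lift_rules[OF o])
qed

instantiation tensor :: (complex_algebra, complex_algebra) complex_algebra
begin
definition times_tensor :: "('a, 'b) tensor \<Rightarrow> ('a, 'b) tensor \<Rightarrow> ('a, 'b) tensor" where
  "times_tensor = tensor_mult"
instance
proof
  fix x y z :: "('a, 'b) tensor" and c :: complex
  note bil = cbilinear_tensor_mult[where 'a = 'a and 'b = 'b, unfolded cbilinear_iff]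
  show "(x + y) * z = x * z + y * z" "x * (y + z) = x * y + x * z"
    "(c *\<^sub>C x) * y = c *\<^sub>C (x * y)" "x * (c *\<^sub>C y) = c *\<^sub>C (x * y)"
    using bil by (auto simp: times_tensor_def)
  show "x * y * z = x * (y * z)"
    unfolding times_tensor_def
  proof (induction x rule: tensor_induct)
    case (tens a b)
    show ?case
    proof (induction y rule: tensor_induct)
      case (tens c d)
      show ?case
        by (induction z rule: tensor_induct) (use bil in \<open>simp_all add: tensor_mult_tens mult.assoc\<close>)
    qed (use bil in simp)
  qed (use bil in simp)
qed
end

lemma tens_mult: "(a \<otimes>\<^sub>t b) * (c \<otimes>\<^sub>t d) = (a * c) \<otimes>\<^sub>t (b * d)"
  by (simp add: times_tensor_def tensor_mult_tens)

instantiation tensor :: ("{complex_algebra,monoid_mult}", "{complex_algebra,monoid_mult}") monoid_mult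
begin
definition one_tensor :: "('a, 'b) tensor" where
  "one_tensor = 1 \<otimes>\<^sub>t 1"
instance
proof
  fix x :: "('a, 'b) tensor"
  show "1 * x = x"
    by (induction x rule: tensor_induct) (simp_all add: one_tensor_def tens_mult distrib_left)
  show "x * 1 = x"
    by (induction x rule: tensor_induct) (simp_all add: one_tensor_def tens_mult distrib_right)
qed
end

instantiation tensor :: (complex_star_algebra, complex_star_algebra) complex_star_algebra
begin
definition star_tensor :: "('a, 'b) tensor \<Rightarrow> ('a, 'b) tensor" where
  "star_tensor = (THE F. (\<forall>x y. F (x + y) = F x + F y) \<and> (\<forall>c x. F (c *\<^sub>C x) = cnj c *\<^sub>C F x) \<and>
     (\<forall>a b. F (a \<otimes>\<^sub>t b) = star a \<otimes>\<^sub>t star b))"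
instance
proof
  fix x y :: "('a, 'b) tensor" and c :: complex
  have "\<exists>!F :: ('a, 'b) tensor \<Rightarrow> ('a, 'b) tensor.
      (\<forall>x y. F (x + y) = F x + F y) \<and> (\<forall>c x. F (c *\<^sub>C x) = cnj c *\<^sub>C F x) \<and>
      (\<forall>a b. F (a \<otimes>\<^sub>t b) = star a \<otimes>\<^sub>t star b)"
    by (rule tensor_universal) (simp_all add: star_add star_scaleC tens_rules)
  from theI'[OF this] have s:
      "star (x + y) = star x + star y" "star (c *\<^sub>C x) = cnj c *\<^sub>C star x"
      "star (a \<otimes>\<^sub>t b) = star a \<otimes>\<^sub>t star b" for x y :: "('a, 'b) tensor" and c a b
    unfolding star_tensor_def by blast+
  show "star (x + y) = star x + star y" "star (c *\<^sub>C x) = cnj c *\<^sub>C star x"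
    by (rule s)+
  show "star (star x) = x"
    by (induction x rule: tensor_induct) (simp_all add: s star_star)
  show "star (x * y) = star y * star x"
  proof (induction x rule: tensor_induct)
    case (tens a b)
    show ?case
      by (induction y rule: tensor_induct) (simp_all add: s tens_mult star_mult distrib_left distrib_right)
  qed (simp add: s distrib_left distrib_right)
qed
end


section \<open>The multiplier algebra\<close>

text \<open>A multiplier is a pair \<open>(a \<mapsto> ma, a \<mapsto> am)\<close>.\<close>

typedef (overloaded) 'a multiplier =
  "{(L, R). clinear L \<and> clinear R \<and> (\<forall>a b. R b * a = b * L a)}
     :: (('a::complex_algebra \<Rightarrow> 'a) \<times> ('a \<Rightarrow> 'a)) set"
  by (rule exI[of _ "(\<lambda>x. x, \<lambda>x. x)"]) (simp add: clinear_iff)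

setup_lifting type_definition_multiplier

lift_definition lmul :: "'a::complex_algebra multiplier \<Rightarrow> 'a \<Rightarrow> 'a" is fst .

text \<open>\<open>rmul m a\<close> is the product \<open>am\<close>.\<close>

lift_definition rmul :: "'a::complex_algebra multiplier \<Rightarrow> 'a \<Rightarrow> 'a" is snd .

lemma multiplier_eqI: "(\<And>a. lmul m a = lmul n a) \<Longrightarrow> (\<And>a. rmul m a = rmul n a) \<Longrightarrow> m = n"
  by transfer (auto simp: fun_eq_iff prod_eq_iff)

lemma clinear_lmul: "clinear (lmul m)" and clinear_rmul: "clinear (rmul m)"
  and rmul_mult: "rmul m b * a = b * lmul m a"
  by (transfer; auto)+

lemma lmul_rules: "lmul m (a + b) = lmul m a + lmul m b" "lmul m (c *\<^sub>C a) = c *\<^sub>C lmul m a"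
  and rmul_rules: "rmul m (a + b) = rmul m a + rmul m b" "rmul m (c *\<^sub>C a) = c *\<^sub>C rmul m a"
  using clinear_lmul[of m] clinear_rmul[of m] unfolding clinear_iff by blast+

instantiation multiplier :: (complex_algebra) complex_algebra
begin
lift_definition zero_multiplier :: "'a multiplier" is "(\<lambda>a. 0, \<lambda>a. 0)"
  by (simp add: clinear_iff)
lift_definition plus_multiplier :: "'a multiplier \<Rightarrow> 'a multiplier \<Rightarrow> 'a multiplier"
  is "\<lambda>(L, R) (L', R'). (\<lambda>a. L a + L' a, \<lambda>a. R a + R' a)"
  by (auto simp: clinear_iff algebra_simps scaleC_add_right)
lift_definition uminus_multiplier :: "'a multiplier \<Rightarrow> 'a multiplier"
  is "\<lambda>(L, R). (\<lambda>a. - L a, \<lambda>a. - R a)"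
  by (auto simp: clinear_iff)
lift_definition minus_multiplier :: "'a multiplier \<Rightarrow> 'a multiplier \<Rightarrow> 'a multiplier"
  is "\<lambda>(L, R) (L', R'). (\<lambda>a. L a - L' a, \<lambda>a. R a - R' a)"
  by (auto simp: clinear_iff algebra_simps cvs.scale_right_diff_distrib)
lift_definition scaleC_multiplier :: "complex \<Rightarrow> 'a multiplier \<Rightarrow> 'a multiplier"
  is "\<lambda>c (L, R). (\<lambda>a. c *\<^sub>C L a, \<lambda>a. c *\<^sub>C R a)"
  by (auto simp: clinear_iff scaleC_add_right scaleC_scaleC mult.commute mult_scaleC_left mult_scaleC_right)
lift_definition times_multiplier :: "'a multiplier \<Rightarrow> 'a multiplier \<Rightarrow> 'a multiplier"
  is "\<lambda>(L, R) (L', R'). (\<lambda>a. L (L' a), \<lambda>a. R' (R a))"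
  by (auto simp: clinear_iff)
instance
  by standard (transfer; auto simp: algebra_simps scaleC_add_right scaleC_add_left scaleC_scaleC
      scaleC_one clinear_iff)+
end

instantiation multiplier :: (complex_algebra) monoid_mult
begin
lift_definition one_multiplier :: "'a multiplier" is "(\<lambda>a. a, \<lambda>a. a)"
  by (simp add: clinear_iff)
instance by standard (transfer; auto)+
end

text \<open>The involution is determined by \<open>m\<^sup>* a = (a\<^sup>* m)\<^sup>*\<close> and \<open>a m\<^sup>* = (m a\<^sup>* )\<^sup>*\<close>.\<close>

instantiation multiplier :: (complex_star_algebra) complex_star_algebra
begin
lift_definition star_multiplier :: "'a multiplier \<Rightarrow> 'a multiplier"
  is "\<lambda>(L, R). (\<lambda>a. star (R (star a)), \<lambda>a. star (L (star a)))"
  by (auto simp: clinear_iff star_add star_scaleC) (metis star_mult star_star)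
instance
  by standard (transfer; auto simp: star_add star_scaleC star_star)+
end

lift_definition of_alg :: "'a::complex_algebra \<Rightarrow> 'a multiplier" is "\<lambda>a. (\<lambda>b. a * b, \<lambda>b. b * a)"
  by (auto simp: clinear_iff algebra_simps mult_scaleC_left mult_scaleC_right)

lemma lmul_simps [simp]:
  "lmul 0 a = 0" "lmul (m + n) a = lmul m a + lmul n a" "lmul (k *\<^sub>C m) a = k *\<^sub>C lmul m a"
  "lmul (m * n) a = lmul m (lmul n a)" "lmul 1 a = a" "lmul (of_alg b) a = b * a"
  and rmul_simps [simp]:
  "rmul 0 a = 0" "rmul (m + n) a = rmul m a + rmul n a" "rmul (k *\<^sub>C m) a = k *\<^sub>C rmul m a"
  "rmul (m * n) a = rmul n (rmul m a)" "rmul 1 a = a" "rmul (of_alg b) a = a * b"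
  by (transfer; auto)+

text \<open>The multiplier \<open>m \<otimes> n\<close> of \<open>A \<otimes> B\<close>.\<close>

lift_definition multiplier_tens ::
    "'a::complex_algebra multiplier \<Rightarrow> 'b::complex_algebra multiplier \<Rightarrow> ('a, 'b) tensor multiplier"
  is "\<lambda>(L, R) (L', R'). (map_tensor L L', map_tensor R R')"
proof -
  fix p :: "('a \<Rightarrow> 'a) \<times> ('a \<Rightarrow> 'a)" and q :: "('b \<Rightarrow> 'b) \<times> ('b \<Rightarrow> 'b)"
  assume p: "p \<in> {(L, R). clinear L \<and> clinear R \<and> (\<forall>a b. R b * a = b * L a)}"
    and q: "q \<in> {(L, R). clinear L \<and> clinear R \<and> (\<forall>a b. R b * a = b * L a)}"
  obtain L R L' R' where pq: "p = (L, R)" "q = (L', R')" by (cases p; cases q)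
  have L: "clinear L" "clinear R" "\<And>a b. R b * a = b * L a"
    and L': "clinear L'" "clinear R'" "\<And>a b. R' b * a = b * L' a"
    using p q unfolding pq by auto
  note m = clinear_map_tensor[OF L(1) L'(1)] clinear_map_tensor[OF L(2) L'(2)]
  have "map_tensor R R' b * a = b * map_tensor L L' a" for a b
  proof (induction a rule: tensor_induct)
    case (tens a a')
    show ?case
      by (induction b rule: tensor_induct)
         (use m(2) in \<open>simp_all add: clinear_iff[of "map_tensor R R'"]
            map_tensor_tens[OF L(1) L'(1)] map_tensor_tens[OF L(2) L'(2)]
            L(3) L'(3) tens_mult distrib_right\<close>)
  qed (use m in \<open>simp add: clinear_iff distrib_left\<close>)
  then show "(case p of (L, R) \<Rightarrow> \<lambda>(L', R'). (map_tensor L L', map_tensor R R')) q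
      \<in> {(L, R). clinear L \<and> clinear R \<and> (\<forall>a b. R b * a = b * L a)}"
    using m by (simp add: pq)
qed

lemma lmul_multiplier_tens: "lmul (multiplier_tens m n) = map_tensor (lmul m) (lmul n)"
  and rmul_multiplier_tens: "rmul (multiplier_tens m n) = map_tensor (rmul m) (rmul n)"
  by (transfer; auto)+

lemma lmul_multiplier_tens_tens [simp]:
  "lmul (multiplier_tens m n) (a \<otimes>\<^sub>t b) = lmul m a \<otimes>\<^sub>t lmul n b"
  and rmul_multiplier_tens_tens [simp]:
  "rmul (multiplier_tens m n) (a \<otimes>\<^sub>t b) = rmul m a \<otimes>\<^sub>t rmul n b"
  by (simp_all add: lmul_multiplier_tens rmul_multiplier_tens map_tensor_tens clinear_lmul clinear_rmul)

lemma cbilinear_multiplier_tens: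
  "cbilinear (multiplier_tens :: 'a::complex_algebra multiplier \<Rightarrow> 'b::complex_algebra multiplier \<Rightarrow> _)"
proof -
  have [simp]: "multiplier_tens (m + m') n = multiplier_tens m n + multiplier_tens m' n"
    "multiplier_tens m (n + n') = multiplier_tens m n + multiplier_tens m n'"
    "multiplier_tens (c *\<^sub>C m) n = c *\<^sub>C multiplier_tens m n"
    "multiplier_tens m (c *\<^sub>C n) = c *\<^sub>C multiplier_tens m n"
    for m m' :: "'a multiplier" and n n' :: "'b multiplier" and c
    by (rule multiplier_eqI; induct_tac a rule: tensor_induct;
        simp add: tens_rules lmul_rules rmul_rules cvs.scale_right_distrib)+
  show ?thesis by (simp add: cbilinear_iff)
qed

text \<open>The canonical map of \<open>M(A) \<otimes> M(B)\<close> into \<open>M(A \<otimes> B)\<close>, injective for nondegenerate products.\<close>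

definition multiplier_embed ::
    "('a::complex_algebra multiplier, 'b::complex_algebra multiplier) tensor \<Rightarrow> ('a, 'b) tensor multiplier" where
  "multiplier_embed = tensor_lift multiplier_tens"


section \<open>Extension of nondegenerate homomorphisms\<close>

definition nondegenerate_hom ::
    "('a::complex_algebra \<Rightarrow> 'b::complex_algebra multiplier) \<Rightarrow> bool" where
  "nondegenerate_hom \<Phi> \<longleftrightarrow> algebra_hom \<Phi> \<and>
     cvs.span {lmul (\<Phi> a) b | a b. True} = UNIV \<and> cvs.span {rmul (\<Phi> a) b | a b. True} = UNIV"

definition is_multiplier_extension ::
    "('a::complex_algebra \<Rightarrow> 'b::complex_algebra multiplier) \<Rightarrow> ('a multiplier \<Rightarrow> 'b multiplier) \<Rightarrow> bool" where
  "is_multiplier_extension \<Phi> \<Psi> \<longleftrightarrow> unital_algebra_hom \<Psi> \<and> (\<forall>a. \<Psi> (of_alg a) = \<Phi> a)"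

definition multiplier_extension ::
    "('a::complex_algebra \<Rightarrow> 'b::complex_algebra multiplier) \<Rightarrow> 'a multiplier \<Rightarrow> 'b multiplier" where
  "multiplier_extension \<Phi> = (THE \<Psi>. is_multiplier_extension \<Phi> \<Psi>)"

lemma multiplier_eq_left:
  assumes "nondegenerate_product TYPE('a::complex_algebra)" and "\<And>a. lmul m a = lmul n (a::'a)"
  shows "m = n"
proof (rule multiplier_eqI)
  fix b :: 'a
  have "(rmul m b - rmul n b) * a = 0" for a
    using assms(2) by (simp add: left_diff_distrib rmul_mult)
  then show "rmul m b = rmul n b"
    using assms(1) unfolding nondegenerate_product_def by (metis eq_iff_diff_eq_0)
qed (rule assms(2))

lemma multiplier_extension_exists:
  fixes \<Phi> :: "'a::complex_algebra \<Rightarrow> 'b::complex_algebra multiplier"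
  assumes ndA: "nondegenerate_product TYPE('a)" and nd: "nondegenerate_product TYPE('b)"
    and \<Phi>: "nondegenerate_hom \<Phi>"
  shows "\<exists>!\<Psi>. is_multiplier_extension \<Phi> \<Psi>"
proof -
  have hom: "\<Phi> (a + a') = \<Phi> a + \<Phi> a'" "\<Phi> (c *\<^sub>C a) = c *\<^sub>C \<Phi> a" "\<Phi> (a * a') = \<Phi> a * \<Phi> a'" for a a' c
    using \<Phi> by (simp_all add: nondegenerate_hom_def algebra_hom_def clinear_iff)
  define \<mu> where "\<mu> = tensor_lift (\<lambda>a b. lmul (\<Phi> a) b)"
  define \<mu>' where "\<mu>' = tensor_lift (\<lambda>a b. rmul (\<Phi> a) b)"
  define \<nu> where "\<nu> m = tensor_lift (\<lambda>a b. lmul (\<Phi> (lmul m a)) b)" for m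
  define \<nu>' where "\<nu>' m = tensor_lift (\<lambda>a b. rmul (\<Phi> (rmul m a)) b)" for m
  have bil: "cbilinear (\<lambda>a b. lmul (\<Phi> a) b)" "cbilinear (\<lambda>a b. rmul (\<Phi> a) b)"
    "cbilinear (\<lambda>a b. lmul (\<Phi> (lmul m a)) b)" "cbilinear (\<lambda>a b. rmul (\<Phi> (rmul m a)) b)" for m
    by (simp_all add: cbilinear_iff hom lmul_rules rmul_rules)
  note lin = clinear_tensor_lift[OF bil(1), folded \<mu>_def] clinear_tensor_lift[OF bil(2), folded \<mu>'_def]
    clinear_tensor_lift[OF bil(3), folded \<nu>_def] clinear_tensor_lift[OF bil(4), folded \<nu>'_def]
  note add = lin[unfolded clinear_iff, THEN conjunct1, rule_format]
    and scale = lin[unfolded clinear_iff, THEN conjunct2, rule_format]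
  note on_tens = tensor_lift_tens[OF bil(1), folded \<mu>_def] tensor_lift_tens[OF bil(2), folded \<mu>'_def]
    tensor_lift_tens[OF bil(3), folded \<nu>_def] tensor_lift_tens[OF bil(4), folded \<nu>'_def]
  have key: "\<mu>' s * \<nu> m t = \<nu>' m s * \<mu> t" for s t m
  proof (induction s rule: tensor_induct)
    case (tens a b)
    show ?case
    proof (induction t rule: tensor_induct)
      case (tens c d)
      have "rmul (\<Phi> a) b * lmul (\<Phi> (lmul m c)) d = b * lmul (\<Phi> (a * lmul m c)) d"
        by (simp add: rmul_mult hom)
      also have "\<dots> = b * lmul (\<Phi> (rmul m a * c)) d" by (simp only: rmul_mult)
      also have "\<dots> = rmul (\<Phi> (rmul m a)) b * lmul (\<Phi> c) d"
        unfolding hom by (simp add: rmul_mult)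
      finally show ?case by (simp add: on_tens)
    qed (simp add: add distrib_left)
  qed (simp add: add distrib_right)
  have range_tensor: "\<exists>t. tensor_lift f t = x"
    if "cbilinear f" "cvs.span {f a b | a b. True} = UNIV" for f :: "'a \<Rightarrow> 'b \<Rightarrow> 'b" and x
  proof -
    have "x \<in> cvs.span {f a b | a b. True}" using that(2) by simp
    then show ?thesis
    proof (induction rule: cvs.span_induct_alt)
      case base
      show ?case using tensor_lift_rules(2)[OF that(1), of 0 0] by auto
    next
      case (step c x y)
      then obtain a b t where "x = f a b" "tensor_lift f t = y" by blast
      then have "tensor_lift f (c *\<^sub>C (a \<otimes>\<^sub>t b) + t) = c *\<^sub>C x + y"
        by (simp add: tensor_lift_rules[OF that(1)] tensor_lift_tens[OF that(1)])
      then show ?case by blast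
    qed
  qed
  have surj: "\<exists>t. \<mu> t = x" "\<exists>s. \<mu>' s = x" for x
    using range_tensor[OF bil(1)] range_tensor[OF bil(2)] \<Phi>
    unfolding \<mu>_def \<mu>'_def nondegenerate_hom_def by blast+
  have left_cancel: "x = y" if "\<And>b. b * x = b * y" for x y :: 'b
  proof -
    have "\<forall>b. b * (x - y) = 0" using that by (simp add: right_diff_distrib)
    then show ?thesis using nd unfolding nondegenerate_product_def by (metis eq_iff_diff_eq_0)
  qed
  have right_cancel: "x = y" if "\<And>b. x * b = y * b" for x y :: 'b
  proof -
    have "\<forall>b. (x - y) * b = 0" using that by (simp add: left_diff_distrib)
    then show ?thesis using nd unfolding nondegenerate_product_def by (metis eq_iff_diff_eq_0)
  qed
  have "\<exists>n. \<forall>t. lmul n (\<mu> t) = \<nu> m t" for m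
  proof -
    have "\<exists>y. \<forall>t. \<mu> t = x \<longrightarrow> \<nu> m t = y" for x
    proof (intro exI allI impI)
      fix t assume "\<mu> t = x"
      have "\<mu> (SOME t. \<mu> t = x) = x" using surj(1) by (metis (mono_tags) someI_ex)
      then show "\<nu> m t = \<nu> m (SOME t. \<mu> t = x)"
        using left_cancel key surj(2) \<open>\<mu> t = x\<close> by metis
    qed
    then obtain L where L: "\<And>t. L (\<mu> t) = \<nu> m t" by metis
    have "\<exists>y. \<forall>s. \<mu>' s = x \<longrightarrow> \<nu>' m s = y" for x
    proof (intro exI allI impI)
      fix s assume "\<mu>' s = x"
      have "\<mu>' (SOME s. \<mu>' s = x) = x" using surj(2) by (metis (mono_tags) someI_ex)
      then show "\<nu>' m s = \<nu>' m (SOME s. \<mu>' s = x)"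
        using right_cancel key surj(1) \<open>\<mu>' s = x\<close> by metis
    qed
    then obtain R where R: "\<And>s. R (\<mu>' s) = \<nu>' m s" by metis
    have "L (x + y) = L x + L y" "L (c *\<^sub>C x) = c *\<^sub>C L x" for x y c
      using surj(1) L add(1,3) scale(1,3) by metis+
    moreover have "R (x + y) = R x + R y" "R (c *\<^sub>C x) = c *\<^sub>C R x" for x y c
      using surj(2) R add(2,4) scale(2,4) by metis+
    moreover have "R y * x = y * L x" for x y
      using surj key L R by metis
    ultimately have "(L, R) \<in> {(L, R). clinear L \<and> clinear R \<and> (\<forall>a b. R b * a = b * L a)}"
      by (simp add: clinear_iff)
    then have "lmul (Abs_multiplier (L, R)) = L"
      by (simp add: lmul.rep_eq Abs_multiplier_inverse)
    then show ?thesis using L by metis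
  qed
  then obtain \<Psi> where \<Psi>: "\<And>m t. lmul (\<Psi> m) (\<mu> t) = \<nu> m t" by metis
  have eqI: "n = n'" if "\<And>a b. lmul n (lmul (\<Phi> a) b) = lmul n' (lmul (\<Phi> a) b)" for n n'
  proof (rule multiplier_eq_left[OF nd])
    fix x
    obtain t where "x = \<mu> t" using surj(1) by metis
    moreover have "lmul n (\<mu> t) = lmul n' (\<mu> t)"
      by (induction t rule: tensor_induct) (simp_all add: on_tens that add lmul_rules)
    ultimately show "lmul n x = lmul n' x" by simp
  qed
  have \<Psi>_gen: "lmul (\<Psi> m) (lmul (\<Phi> a) b) = lmul (\<Phi> (lmul m a)) b" for m a b
    using \<Psi>[of m "a \<otimes>\<^sub>t b"] by (simp add: on_tens)
  show ?thesis
  proof (rule ex1I)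
    have "\<Psi> (m + m') = \<Psi> m + \<Psi> m'" "\<Psi> (c *\<^sub>C m) = c *\<^sub>C \<Psi> m" "\<Psi> (m * m') = \<Psi> m * \<Psi> m'"
      "\<Psi> 1 = 1" "\<Psi> (of_alg a) = \<Phi> a" for m m' c a
      by (rule eqI; simp add: \<Psi>_gen hom)+
    then show "is_multiplier_extension \<Phi> \<Psi>"
      by (simp add: is_multiplier_extension_def unital_algebra_hom_def algebra_hom_def clinear_iff)
  next
    fix \<Psi>' assume \<Psi>': "is_multiplier_extension \<Phi> \<Psi>'"
    have m: "m * of_alg a = of_alg (lmul m a)" for m :: "'a multiplier" and a
    proof (rule multiplier_eq_left[OF ndA])
      fix x
      have "b * lmul m (a * x) = b * (lmul m a * x)" for b
      proof -
        have "b * lmul m (a * x) = rmul m b * a * x" by (simp add: rmul_mult[symmetric] mult.assoc)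
        then show ?thesis by (simp add: rmul_mult mult.assoc)
      qed
      then have "\<forall>b. b * (lmul m (a * x) - lmul m a * x) = 0"
        by (simp add: right_diff_distrib)
      then have "lmul m (a * x) - lmul m a * x = 0"
        using ndA unfolding nondegenerate_product_def by blast
      then show "lmul (m * of_alg a) x = lmul (of_alg (lmul m a)) x" by simp
    qed
    have "\<Psi>' m = \<Psi> m" for m
    proof (rule eqI)
      fix a b
      have "\<Psi>' (m * of_alg a) = \<Psi>' m * \<Psi>' (of_alg a)"
        using \<Psi>' by (simp add: is_multiplier_extension_def unital_algebra_hom_def algebra_hom_def)
      then have "\<Phi> (lmul m a) = \<Psi>' m * \<Phi> a"
        using \<Psi>' by (simp add: m is_multiplier_extension_def)
      then show "lmul (\<Psi>' m) (lmul (\<Phi> a) b) = lmul (\<Psi> m) (lmul (\<Phi> a) b)"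
        by (simp add: \<Psi>_gen)
    qed
    then show "\<Psi>' = \<Psi>" by blast
  qed
qed


section \<open>Discrete quantum groups\<close>

definition galois1 :: "('a::complex_algebra \<Rightarrow> ('a, 'a) tensor multiplier) \<Rightarrow>
    ('a, 'a) tensor \<Rightarrow> ('a, 'a) tensor multiplier" where
  "galois1 \<delta> = tensor_lift (\<lambda>a b. \<delta> a * multiplier_tens 1 (of_alg b))"

definition galois2 :: "('a::complex_algebra \<Rightarrow> ('a, 'a) tensor multiplier) \<Rightarrow>
    ('a, 'a) tensor \<Rightarrow> ('a, 'a) tensor multiplier" where
  "galois2 \<delta> = tensor_lift (\<lambda>a b. multiplier_tens (of_alg a) 1 * \<delta> b)"

text \<open>The maps \<open>T\<^sub>1\<close> and \<open>T\<^sub>2\<close>, read as maps of \<open>A \<otimes> A\<close> to itself through the embedding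
  \<^const>\<open>of_alg\<close> of \<open>A \<otimes> A\<close> in \<open>M(A \<otimes> A)\<close>.\<close>

definition T1 :: "('a::complex_algebra \<Rightarrow> ('a, 'a) tensor multiplier) \<Rightarrow>
    ('a, 'a) tensor \<Rightarrow> ('a, 'a) tensor" where
  "T1 \<delta> x = inv_into UNIV of_alg (galois1 \<delta> x)"

definition T2 :: "('a::complex_algebra \<Rightarrow> ('a, 'a) tensor multiplier) \<Rightarrow>
    ('a, 'a) tensor \<Rightarrow> ('a, 'a) tensor" where
  "T2 \<delta> x = inv_into UNIV of_alg (galois2 \<delta> x)"

text \<open>\<open>A \<otimes> A \<otimes> A\<close> is \<open>(A \<otimes> A) \<otimes> A\<close>; there \<open>id \<otimes> T\<^sub>1\<close> is conjugated by the associator.\<close>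

definition multiplier_hopf_algebra ::
    "('a::complex_algebra \<Rightarrow> ('a, 'a) tensor multiplier) \<Rightarrow> bool" where
  "multiplier_hopf_algebra \<delta> \<longleftrightarrow>
     nondegenerate_product TYPE('a) \<and> algebra_hom \<delta> \<and>
     bij_betw (galois1 \<delta>) UNIV (range of_alg) \<and>
     bij_betw (galois2 \<delta>) UNIV (range of_alg) \<and>
     (let T2_id = map_tensor (T2 \<delta>) (\<lambda>x. x);
          id_T1 = tensor_assoc_inv \<circ> map_tensor (\<lambda>x. x) (T1 \<delta>) \<circ> tensor_assoc
      in T2_id \<circ> id_T1 = id_T1 \<circ> T2_id)"

definition multiplier_hopf_star_algebra ::
    "('a::complex_star_algebra \<Rightarrow> ('a, 'a) tensor multiplier) \<Rightarrow> bool" where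
  "multiplier_hopf_star_algebra \<delta> \<longleftrightarrow>
     multiplier_hopf_algebra \<delta> \<and> (\<forall>a. \<delta> (star a) = star (\<delta> a))"

text \<open>The algebraic direct sum of the full matrix algebras of size \<open>n i\<close>, \<open>i \<in> I\<close>.\<close>

definition matrix_direct_sum :: "'i set \<Rightarrow> ('i \<Rightarrow> nat) \<Rightarrow> ('i \<Rightarrow> complex mat) set" where
  "matrix_direct_sum I n =
     {f \<in> (\<Pi>\<^sub>E i\<in>I. carrier_mat (n i) (n i)). finite {i \<in> I. f i \<noteq> 0\<^sub>m (n i) (n i)}}"

definition is_matrix_direct_sum ::
    "'a::complex_algebra itself \<Rightarrow> 'i set \<Rightarrow> ('i \<Rightarrow> nat) \<Rightarrow> bool" where
  "is_matrix_direct_sum (_ :: 'a itself) I n \<longleftrightarrow>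
     (\<forall>i\<in>I. 0 < n i) \<and>
     (\<exists>\<phi> :: 'a \<Rightarrow> 'i \<Rightarrow> complex mat. bij_betw \<phi> UNIV (matrix_direct_sum I n) \<and>
        (\<forall>i\<in>I. \<forall>a b. \<phi> (a + b) i = \<phi> a i + \<phi> b i) \<and>
        (\<forall>i\<in>I. \<forall>c a. \<phi> (c *\<^sub>C a) i = c \<cdot>\<^sub>m \<phi> a i) \<and>
        (\<forall>i\<in>I. \<forall>a b. \<phi> (a * b) i = \<phi> a i * \<phi> b i))"

text \<open>The identification with a direct sum of matrix algebras is one of algebras; the involution is not
  required to be the blockwise adjoint.\<close>

definition discrete_quantum_group ::
    "('a::complex_star_algebra \<Rightarrow> ('a, 'a) tensor multiplier) \<Rightarrow> 'i set \<Rightarrow> ('i \<Rightarrow> nat) \<Rightarrow> bool" where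
  "discrete_quantum_group \<delta> I n \<longleftrightarrow>
     multiplier_hopf_star_algebra \<delta> \<and> is_matrix_direct_sum TYPE('a) I n"


section \<open>Hopf algebras\<close>

definition hopf_algebra ::
    "('h::{complex_algebra,monoid_mult} \<Rightarrow> ('h, 'h) tensor) \<Rightarrow> ('h \<Rightarrow> complex) \<Rightarrow> ('h \<Rightarrow> 'h) \<Rightarrow> bool" where
  "hopf_algebra \<Delta> \<epsilon> S \<longleftrightarrow>
     unital_algebra_hom \<Delta> \<and> unital_algebra_hom \<epsilon> \<and> clinear S \<and>
     (\<forall>h. tensor_assoc (map_tensor \<Delta> (\<lambda>x. x) (\<Delta> h)) = map_tensor (\<lambda>x. x) \<Delta> (\<Delta> h)) \<and>
     (\<forall>h. tensor_lift (\<lambda>x y. \<epsilon> x *\<^sub>C y) (\<Delta> h) = h) \<and>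
     (\<forall>h. tensor_lift (\<lambda>x y. \<epsilon> y *\<^sub>C x) (\<Delta> h) = h) \<and>
     (\<forall>h. tensor_lift (\<lambda>x y. S x * y) (\<Delta> h) = \<epsilon> h *\<^sub>C 1) \<and>
     (\<forall>h. tensor_lift (\<lambda>x y. x * S y) (\<Delta> h) = \<epsilon> h *\<^sub>C 1)"

text \<open>\<open>(M(A), D)\<close> is a Hopf algebra: \<open>D\<close> factors through \<open>M(A) \<otimes> M(A)\<close>, by the comultiplication
  of a Hopf algebra.\<close>

definition multiplier_algebra_is_hopf ::
    "('a::complex_algebra multiplier \<Rightarrow> ('a, 'a) tensor multiplier) \<Rightarrow> bool" where
  "multiplier_algebra_is_hopf D \<longleftrightarrow>
     (\<exists>\<Delta> \<epsilon> S. (\<forall>m. D m = multiplier_embed (\<Delta> m)) \<and> hopf_algebra \<Delta> \<epsilon> S)"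

end

(* Write A as the direct sum of its blocks A_j = e_j A with e_j a central idempotent, and fix a block
   A_i.  If delta maps A into M(A) (x) M(A), then the left legs of delta(A_i) span a finite
   dimensional subspace W of M(A), as A_i is finite dimensional.  Since T_1 is onto,
     delta(e_i)(A (x) A) = T_1(e_i A (x) A),
   so the left legs of delta(e_i)(e_j (x) b) lie in W as well as in A_j.  Since T_2 is injective,
   (e_j (x) 1) delta(e_i) = T_2(e_j (x) e_i) is nonzero, so W meets every A_j nontrivially, which
   is impossible for infinitely many j.  To stay inside A, W is cut down by the idempotent
   sum e F for a set F of more than dim W blocks. *)

theory Submission
  imports Defs
begin

section \<open>Slices of tensors\<close>

text \<open>This is \<open>id\<close> tensor \<open>f\<close>, contracting the second leg with a
  functional. Its values are the left legs of a tensor, which turns leg arguments into linear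
  algebra in the first factor.\<close>

definition slice :: "('b::complex_vector \<Rightarrow> complex) \<Rightarrow> ('a::complex_vector, 'b) tensor \<Rightarrow> 'a" where
  "slice f = tensor_lift (\<lambda>a b. f b *\<^sub>C a)"

lemma cbilinear_slice:
  assumes "clinear f"
  shows "cbilinear (\<lambda>(a::'a::complex_vector) b. f b *\<^sub>C a)"
  using assms
  by (simp add: cbilinear_iff clinear_iff scaleC_add_right scaleC_add_left scaleC_scaleC
      scaleC_complex_def mult.commute)

lemma slice_simps:
  fixes f :: "'a::complex_vector \<Rightarrow> complex" and a :: "'b::complex_vector"
  assumes "clinear f"
  shows slice_tens: "slice f (a \<otimes>\<^sub>t b) = f b *\<^sub>C a"
    and slice_add: "slice f (x + y) = slice f x + slice f (y :: ('b, 'a) tensor)"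
    and slice_scaleC: "slice f (c *\<^sub>C x) = c *\<^sub>C slice f x"
    and slice_0: "slice f (0 :: ('b, 'a) tensor) = 0"
proof -
  note bil = cbilinear_slice[OF assms]
  show "slice f (a \<otimes>\<^sub>t b) = f b *\<^sub>C a"
    unfolding slice_def by (rule tensor_lift_tens[OF bil])
  show add: "slice f (x + y) = slice f x + slice f y" for x y :: "('b, 'a) tensor"
    unfolding slice_def by (rule tensor_lift_rules[OF bil])
  show "slice f (c *\<^sub>C x) = c *\<^sub>C slice f x"
    unfolding slice_def by (rule tensor_lift_rules[OF bil])
  show "slice f (0 :: ('b, 'a) tensor) = 0" using add[of 0 0] by simp
qed

lemma tens_0_left: "0 \<otimes>\<^sub>t y = 0"
  using tens_rules(1)[of 0 0 y] by simp

lemma tens_0_right: "x \<otimes>\<^sub>t 0 = 0"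
  using tens_rules(2)[of x 0 0] by simp

lemma tens_sum_right: "x \<otimes>\<^sub>t (\<Sum>s\<in>S. g s) = (\<Sum>s\<in>S. x \<otimes>\<^sub>t g s)"
  by (induction S rule: infinite_finite_induct) (simp_all add: tens_rules tens_0_right)

text \<open>A tensor is rebuilt from its slices: expanding second legs in a Hamel basis, the
  coefficient of a basis vector is the slice by its coordinate functional.\<close>

lemma slices_separate:
  fixes x :: "('a::complex_vector, 'b::complex_vector) tensor"
  assumes "\<And>f. clinear f \<Longrightarrow> slice f x = 0"
  shows "x = 0"
proof -
  obtain B :: "'b set" where B: "cvs.independent B" "cvs.span B = UNIV"
    using cvs.independent_empty cvs.independent_extend_basis cvs.span_extend_basis by blast
  define r where "r b v = cvs.representation B v b" for b v
  have r: "clinear (r b)" for b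
    unfolding r_def clinear_iff scaleC_complex_def
    using cvs.representation_add[OF B(1)] cvs.representation_scale[OF B(1)] B(2) by simp
  \<comment> \<open>Asking for the expansion over every finite \<open>S\<close> above some
    \<open>S0\<close>, not over one set, lets the expansions of two summands be taken over a common
    set.\<close>
  have "\<exists>S0. finite S0 \<and> (\<forall>S. finite S \<longrightarrow> S0 \<subseteq> S \<longrightarrow> x = (\<Sum>b\<in>S. slice (r b) x \<otimes>\<^sub>t b))"
  proof (induction x rule: tensor_induct)
    case (tens a v)
    have "a \<otimes>\<^sub>t v = (\<Sum>b\<in>S. slice (r b) (a \<otimes>\<^sub>t v) \<otimes>\<^sub>t b)"
      if S: "finite S" "{b. cvs.representation B v b \<noteq> 0} \<subseteq> S" for S
    proof -
      have "v = (\<Sum>b | cvs.representation B v b \<noteq> 0. cvs.representation B v b *\<^sub>C b)"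
        using cvs.sum_nonzero_representation_eq[OF B(1)] B(2) by (metis UNIV_I)
      also have "\<dots> = (\<Sum>b\<in>S. cvs.representation B v b *\<^sub>C b)"
        by (rule sum.mono_neutral_left) (use S in auto)
      finally have v: "v = (\<Sum>b\<in>S. r b v *\<^sub>C b)" by (simp add: r_def)
      have "a \<otimes>\<^sub>t v = (\<Sum>b\<in>S. a \<otimes>\<^sub>t (r b v *\<^sub>C b))"
        by (subst v) (rule tens_sum_right)
      then show ?thesis unfolding slice_tens[OF r] tens_rules .
    qed
    moreover have "finite {b. cvs.representation B v b \<noteq> 0}"
      by (rule cvs.finite_representation)
    ultimately show ?case by blast
  next
    case (add x y)
    then obtain S T where S: "finite S" "\<And>S'. finite S' \<Longrightarrow> S \<subseteq> S' \<Longrightarrow> x = (\<Sum>b\<in>S'. slice (r b) x \<otimes>\<^sub>t b)"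
      and T: "finite T" "\<And>S'. finite S' \<Longrightarrow> T \<subseteq> S' \<Longrightarrow> y = (\<Sum>b\<in>S'. slice (r b) y \<otimes>\<^sub>t b)"
      by blast
    have "x + y = (\<Sum>b\<in>S'. slice (r b) (x + y) \<otimes>\<^sub>t b)" if "finite S'" "S \<union> T \<subseteq> S'" for S'
    proof -
      have "S \<subseteq> S'" "T \<subseteq> S'" using that by auto
      then show ?thesis
        using S(2)[OF that(1)] T(2)[OF that(1)]
        by (simp add: slice_add[OF r] tens_rules sum.distrib)
    qed
    then show ?case using S(1) T(1) by (intro exI[of _ "S \<union> T"]) auto
  qed
  then obtain S where "x = (\<Sum>b\<in>S. slice (r b) x \<otimes>\<^sub>t b)" by blast
  then show ?thesis by (simp add: assms[OF r] tens_0_left)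
qed

text \<open>A functional with value 1 at \<open>b\<close> slices the elementary tensor back to
  \<open>a\<close>.\<close>

lemma tens_nonzero:
  fixes a :: "'a::complex_vector" and b :: "'b::complex_vector"
  assumes "a \<noteq> 0" "b \<noteq> 0"
  shows "a \<otimes>\<^sub>t b \<noteq> 0"
proof
  assume 0: "a \<otimes>\<^sub>t b = 0"
  interpret complex_space: vector_space_pair "scaleC :: complex \<Rightarrow> 'b \<Rightarrow> 'b" "scaleC :: complex \<Rightarrow> complex \<Rightarrow> complex" ..
  have "cvs.independent {b}" using assms(2) by simp
  from complex_space.linear_independent_extend[OF this, of "\<lambda>_. 1"]
  obtain f :: "'b \<Rightarrow> complex" where f: "clinear f" "f b = 1" by auto
  have "slice f (a \<otimes>\<^sub>t b) = a" by (simp add: slice_tens f scaleC_one)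
  then show False using 0 assms(1) by (simp add: slice_0 f)
qed

section \<open>Multipliers\<close>

text \<open>Multiplying from the left by any \<open>b\<close> moves \<open>m\<close> onto
  \<open>b\<close>, where associativity applies; nondegeneracy then cancels
  \<open>b\<close>.\<close>

lemma lmul_mult:
  assumes "nondegenerate_product TYPE('a::complex_algebra)"
  shows "lmul m (x * y) = lmul m x * (y::'a)"
proof -
  have "\<forall>b. b * (lmul m (x * y) - lmul m x * y) = 0"
    by (simp add: right_diff_distrib mult.assoc[symmetric] rmul_mult[symmetric])
  then have "lmul m (x * y) - lmul m x * y = 0"
    using assms unfolding nondegenerate_product_def by blast
  then show ?thesis by simp
qed

text \<open>For central \<open>z\<close>, the multiplier given by \<open>z\<close> on the first leg
  is central in the multiplier algebra. Later this turns the product defining \<open>galois2\<close>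
  into \<open>\<delta>\<close> acting on tensors whose first leg lies in a fixed block.\<close>

lemma central_tens_commute:
  fixes z :: "'a::complex_algebra" and m :: "('a, 'b::complex_algebra) tensor multiplier"
  assumes nd: "nondegenerate_product TYPE(('a, 'b) tensor)"
    and z: "\<And>a. z * a = a * z"
  shows "multiplier_tens (of_alg z) 1 * m = m * multiplier_tens (of_alg z) 1"
proof (rule multiplier_eq_left[OF nd])
  fix x :: "('a, 'b) tensor"
  define Z where "Z = lmul (multiplier_tens (of_alg z) (1 :: 'b multiplier))"
  have Z_add: "Z (x + y) = Z x + Z y" for x y by (simp add: Z_def lmul_rules)
  have Z_tens: "Z (a \<otimes>\<^sub>t b) = (z * a) \<otimes>\<^sub>t b" for a b by (simp add: Z_def)
  have Z_left: "Z (x * y) = Z x * y" for x y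
    unfolding Z_def by (rule lmul_mult[OF nd])
  have Z_right: "x * Z y = Z (x * y)" for x y
  proof (induction x rule: tensor_induct)
    case (tens a b)
    show ?case
    proof (induction y rule: tensor_induct)
      case (tens c d)
      have "a * (z * c) = z * (a * c)" by (metis mult.assoc z)
      then show ?case by (simp add: Z_tens tens_mult)
    qed (simp add: Z_add distrib_left)
  qed (simp add: Z_add distrib_right)
  \<comment> \<open>Both products equal \<open>rmul m b * Z x\<close>: \<open>Z\<close> slides
    through left factors and \<open>m\<close> moves onto \<open>b\<close>.\<close>
  have "\<forall>b. b * (Z (lmul m x) - lmul m (Z x)) = 0"
    by (simp add: right_diff_distrib Z_right) (metis Z_right rmul_mult)
  then have "Z (lmul m x) - lmul m (Z x) = 0"
    using nd unfolding nondegenerate_product_def by blast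
  then show "lmul (multiplier_tens (of_alg z) 1 * m) x = lmul (m * multiplier_tens (of_alg z) 1) x"
    by (simp add: Z_def)
qed

text \<open>\<open>W\<close> collects the left legs in an expression of \<open>X\<close> as a sum of
  elementary tensors, so it is independent of \<open>f\<close>, \<open>a\<close> and
  \<open>b\<close>. Applying its members to \<open>a\<close> keeps the slices inside the algebra
  itself.\<close>

lemma multiplier_embed_slices:
  fixes X :: "('a::complex_algebra multiplier, 'b::complex_algebra multiplier) tensor"
  shows "\<exists>W. finite W \<and> (\<forall>f a b. clinear f \<longrightarrow>
           slice f (lmul (multiplier_embed X) (a \<otimes>\<^sub>t b)) \<in> cvs.span ((\<lambda>w. lmul w a) ` W))"
proof (induction X rule: tensor_induct)
  case (tens v w)
  show ?case
    by (rule exI[of _ "{v}"])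
       (simp add: multiplier_embed_def tensor_lift_tens[OF cbilinear_multiplier_tens] slice_tens
          cvs.span_base cvs.span_scale)
next
  case (add X Y)
  then obtain V W where V: "finite V" "\<And>f a b. clinear f \<Longrightarrow>
           slice f (lmul (multiplier_embed X) (a \<otimes>\<^sub>t b)) \<in> cvs.span ((\<lambda>w. lmul w a) ` V)"
    and W: "finite W" "\<And>f a b. clinear f \<Longrightarrow>
           slice f (lmul (multiplier_embed Y) (a \<otimes>\<^sub>t b)) \<in> cvs.span ((\<lambda>w. lmul w a) ` W)"
    by blast
  have "slice f (lmul (multiplier_embed (X + Y)) (a \<otimes>\<^sub>t b)) \<in> cvs.span ((\<lambda>w. lmul w a) ` (V \<union> W))"
    if f: "clinear f" for f a b
  proof -
    have "cvs.span ((\<lambda>w. lmul w a) ` V) \<subseteq> cvs.span ((\<lambda>w. lmul w a) ` (V \<union> W))"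
      "cvs.span ((\<lambda>w. lmul w a) ` W) \<subseteq> cvs.span ((\<lambda>w. lmul w a) ` (V \<union> W))"
      by (rule cvs.span_mono, blast)+
    then show ?thesis
      using V(2)[OF f, of a b] W(2)[OF f, of a b]
      by (auto simp: multiplier_embed_def tensor_lift_rules[OF cbilinear_multiplier_tens]
          slice_add[OF f] intro!: cvs.span_add)
  qed
  then show ?case using V(1) W(1) by (intro exI[of _ "V \<union> W"]) auto
qed

lemma
  assumes "algebra_hom \<delta>"
  shows cbilinear_galois1:
      "cbilinear (\<lambda>a b. \<delta> a * multiplier_tens (1 :: 'a::complex_algebra multiplier) (of_alg (b :: 'a)))"
    and cbilinear_galois2:
      "cbilinear (\<lambda>a b. multiplier_tens (of_alg (a :: 'a)) (1 :: 'a multiplier) * \<delta> b)"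
proof -
  have [simp]: "of_alg (x + y) = of_alg x + of_alg y" "of_alg (c *\<^sub>C x) = c *\<^sub>C of_alg x" for x y :: 'a and c
    by (rule multiplier_eqI; simp add: algebra_simps mult_scaleC_left mult_scaleC_right)+
  note [simp] = cbilinear_multiplier_tens[unfolded cbilinear_iff, THEN conjunct1, rule_format]
    cbilinear_multiplier_tens[unfolded cbilinear_iff, THEN conjunct2, THEN conjunct1, rule_format]
    cbilinear_multiplier_tens[unfolded cbilinear_iff, THEN conjunct2, THEN conjunct2, THEN conjunct1, rule_format]
    cbilinear_multiplier_tens[unfolded cbilinear_iff, THEN conjunct2, THEN conjunct2, THEN conjunct2, rule_format]
  show "cbilinear (\<lambda>a b. \<delta> a * multiplier_tens (1 :: 'a multiplier) (of_alg (b :: 'a)))"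
    "cbilinear (\<lambda>a b. multiplier_tens (of_alg (a :: 'a)) (1 :: 'a multiplier) * \<delta> b)"
    using assms unfolding algebra_hom_def clinear_iff
    by (simp_all add: cbilinear_iff distrib_left distrib_right mult_scaleC_left mult_scaleC_right)
qed

section \<open>Direct sums of finite dimensional blocks\<close>

text \<open>The features of a direct sum of full matrix algebras that the argument uses, with
  \<open>e i\<close> as the unit of block \<open>i\<close>. \<open>local_unit\<close> expresses that
  each element has finite support, and \<open>finite_block\<close> that each block is finite
  dimensional.\<close>

locale block_decomposition =
  fixes I :: "'i set" and e :: "'i \<Rightarrow> 'a::complex_algebra"
  assumes central: "i \<in> I \<Longrightarrow> e i * a = a * e i"
    and idem: "i \<in> I \<Longrightarrow> e i * e i = e i"
    and nonzero: "i \<in> I \<Longrightarrow> e i \<noteq> 0"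
    and orth: "i \<in> I \<Longrightarrow> j \<in> I \<Longrightarrow> i \<noteq> j \<Longrightarrow> e i * e j = 0"
    and local_unit: "\<exists>F. finite F \<and> F \<subseteq> I \<and> sum e F * a = a"
    and finite_block: "i \<in> I \<Longrightarrow> \<exists>E. finite E \<and> (\<forall>a. e i * a \<in> cvs.span E)"
begin

lemma sum_central: "F \<subseteq> I \<Longrightarrow> sum e F * a = a * sum e F"
  by (auto simp: sum_distrib_left sum_distrib_right central intro!: sum.cong)

lemma mult_sum:
  assumes "finite F" "F \<subseteq> I" "i \<in> F"
  shows "e i * sum e F = e i"
proof -
  have "e i * sum e F = (\<Sum>j\<in>F. if j = i then e i else 0)"
    unfolding sum_distrib_left using assms idem orth by (intro sum.cong) (auto simp: subset_eq)
  then show ?thesis using assms by simp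
qed

lemma sum_mult_sum:
  assumes "finite G" "F \<subseteq> G" "G \<subseteq> I"
  shows "sum e G * sum e F = sum e F"
proof -
  have "sum e F * sum e G = sum e F"
    unfolding sum_distrib_right using assms by (intro sum.cong) (auto simp: mult_sum)
  then show ?thesis using sum_central[OF assms(3)] by simp
qed

text \<open>The property is stable under enlarging \<open>G\<close>, so that the union of the sets
  found for two summands serves their sum.\<close>

lemma tensor_local_unit:
  fixes x :: "('a, 'a) tensor"
  shows "\<exists>F. finite F \<and> F \<subseteq> I \<and> (\<forall>G. finite G \<longrightarrow> F \<subseteq> G \<longrightarrow> G \<subseteq> I \<longrightarrow>
     (sum e G \<otimes>\<^sub>t sum e G) * x = x \<and> x * (sum e G \<otimes>\<^sub>t sum e G) = x)"
proof (induction x rule: tensor_induct)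
  case (tens a b)
  obtain F H where F: "finite F" "F \<subseteq> I" "sum e F * a = a"
    and H: "finite H" "H \<subseteq> I" "sum e H * b = b"
    using local_unit by metis
  have "sum e G * a = a \<and> sum e G * b = b" if "finite G" "F \<union> H \<subseteq> G" "G \<subseteq> I" for G
    using that sum_mult_sum[of G F] sum_mult_sum[of G H] F H by (metis Un_subset_iff mult.assoc)
  then show ?case
    using F(1,2) H(1,2) sum_central
    by (intro exI[of _ "F \<union> H"]) (auto simp: tens_mult)
next
  case (add x y)
  then obtain F H where "finite F" "F \<subseteq> I" "finite H" "H \<subseteq> I"
    "\<forall>G. finite G \<longrightarrow> F \<subseteq> G \<longrightarrow> G \<subseteq> I \<longrightarrow>
     (sum e G \<otimes>\<^sub>t sum e G) * x = x \<and> x * (sum e G \<otimes>\<^sub>t sum e G) = x"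
    "\<forall>G. finite G \<longrightarrow> H \<subseteq> G \<longrightarrow> G \<subseteq> I \<longrightarrow>
     (sum e G \<otimes>\<^sub>t sum e G) * y = y \<and> y * (sum e G \<otimes>\<^sub>t sum e G) = y"
    by blast
  then show ?case
    by (intro exI[of _ "F \<union> H"]) (simp add: distrib_left distrib_right)
qed

lemma tensor_local_unit':
  fixes x :: "('a, 'a) tensor"
  obtains q :: 'a where "(q \<otimes>\<^sub>t q) * x = x" "x * (q \<otimes>\<^sub>t q) = x"
  using tensor_local_unit[of x] by blast

text \<open>An element annihilated by everything on one side is annihilated by its own local unit,
  hence is 0.\<close>

lemma nondegenerate_tensor: "nondegenerate_product TYPE(('a, 'a) tensor)"
  unfolding nondegenerate_product_def by (metis tensor_local_unit')

lemma finite_dimensional_if_finite: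
  assumes "finite I"
  shows "finite_dimensional TYPE('a)"
proof -
  obtain E where E: "\<And>i. i \<in> I \<Longrightarrow> finite (E i)" "\<And>i a. i \<in> I \<Longrightarrow> e i * a \<in> cvs.span (E i)"
    using finite_block by metis
  have "a \<in> cvs.span (\<Union>i\<in>I. E i)" for a
  proof -
    obtain F where F: "F \<subseteq> I" "sum e F * a = a" using local_unit by metis
    have "(\<Sum>i\<in>F. e i * a) \<in> cvs.span (\<Union>i\<in>I. E i)"
    proof (rule cvs.span_sum)
      fix i assume "i \<in> F"
      then have "i \<in> I" using F(1) by blast
      then have "cvs.span (E i) \<subseteq> cvs.span (\<Union>i\<in>I. E i)" by (intro cvs.span_mono) blast
      then show "e i * a \<in> cvs.span (\<Union>i\<in>I. E i)" using E(2)[OF \<open>i \<in> I\<close>] by blast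
    qed
    then show ?thesis by (simp add: sum_distrib_right[symmetric] F)
  qed
  then show ?thesis
    unfolding finite_dimensional_def using E(1) assms by (intro exI[of _ "\<Union>i\<in>I. E i"]) auto
qed

text \<open>Nonzero vectors from distinct blocks are independent, because multiplying a vanishing
  combination by \<open>e i\<close> isolates its \<open>i\<close>-th term. Hence a span of
  \<open>card W\<close> vectors meets at most that many blocks.\<close>

lemma card_blocks_le:
  assumes F: "finite F" "F \<subseteq> I" and W: "finite W"
    and z: "\<And>i. i \<in> F \<Longrightarrow> z i \<in> cvs.span W" "\<And>i. i \<in> F \<Longrightarrow> e i * z i = z i" "\<And>i. i \<in> F \<Longrightarrow> z i \<noteq> 0"
  shows "card F \<le> card W"
proof -
  have ez: "e i * z j = (if i = j then z i else 0)" if "i \<in> F" "j \<in> F" for i j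
  proof -
    have "e i * z j = e i * e j * z j" using that z(2) by (simp add: mult.assoc)
    then show ?thesis using that F z(2) orth by (auto simp: subset_eq)
  qed
  \<comment> \<open>If \<open>z i = z j\<close> with distinct \<open>i\<close> and \<open>j\<close>,
    then \<open>z i = e i * z j = 0\<close>.\<close>
  have inj: "inj_on z F" by (rule inj_onI) (metis ez z(3))
  have "cvs.independent (z ` F)"
  proof (subst cvs.dependent_finite)
    show "finite (z ` F)" using F by simp
    show "\<not> (\<exists>u. (\<exists>v\<in>z ` F. u v \<noteq> 0) \<and> (\<Sum>v\<in>z ` F. u v *\<^sub>C v) = 0)"
    proof (rule notI, elim exE conjE bexE)
      fix u v assume v: "v \<in> z ` F" "u v \<noteq> 0" and "(\<Sum>v\<in>z ` F. u v *\<^sub>C v) = 0"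
      then have 0: "(\<Sum>j\<in>F. u (z j) *\<^sub>C z j) = 0" by (simp add: sum.reindex[OF inj])
      obtain i where i: "i \<in> F" "v = z i" using v by blast
      have "e i * (\<Sum>j\<in>F. u (z j) *\<^sub>C z j) = (\<Sum>j\<in>F. if i = j then u (z i) *\<^sub>C z i else 0)"
        unfolding sum_distrib_left mult_scaleC_right
        by (rule sum.cong) (auto simp: ez i)
      then have "u (z i) *\<^sub>C z i = 0" using 0 F i by simp
      then show False using v i z(3) by simp
    qed
  qed
  then have "card (z ` F) \<le> card W"
    using cvs.independent_span_bound[OF W] z(1) by blast
  then show ?thesis by (simp add: card_image[OF inj])
qed

section \<open>Legs and nondegeneracy of the comultiplication\<close>

lemma block_slices:
  assumes lin: "clinear \<delta>" and range: "\<And>a. \<delta> a \<in> range multiplier_embed" and i: "i \<in> I"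
  shows "\<exists>W. finite W \<and> (\<forall>f a b c. clinear f \<longrightarrow>
           slice f (lmul (\<delta> (e i * a)) (c \<otimes>\<^sub>t (b :: 'b::complex_algebra)))
             \<in> cvs.span ((\<lambda>w. lmul w (c :: 'c::complex_algebra)) ` W))"
proof -
  note \<delta> = lin[unfolded clinear_iff, THEN conjunct1, rule_format]
    lin[unfolded clinear_iff, THEN conjunct2, rule_format]
  obtain E where E: "finite E" "\<And>a. e i * a \<in> cvs.span E"
    using finite_block[OF i] by blast
  have "\<forall>x. \<exists>W. finite W \<and> (\<forall>f c b. clinear f \<longrightarrow>
      slice f (lmul (\<delta> x) (c \<otimes>\<^sub>t b)) \<in> cvs.span ((\<lambda>w. lmul w c) ` W))"
  proof
    fix x
    obtain X where "\<delta> x = multiplier_embed X" using range[of x] by blast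
    then show "\<exists>W. finite W \<and> (\<forall>f c b. clinear f \<longrightarrow>
        slice f (lmul (\<delta> x) (c \<otimes>\<^sub>t b)) \<in> cvs.span ((\<lambda>w. lmul w c) ` W))"
      using multiplier_embed_slices[of X] by simp
  qed
  from choice[OF this] obtain V where V: "\<And>x. finite (V x)" "\<And>x f c b. clinear f \<Longrightarrow>
      slice f (lmul (\<delta> x) (c \<otimes>\<^sub>t b)) \<in> cvs.span ((\<lambda>w. lmul w c) ` V x)"
    by blast
  \<comment> \<open>By linearity, the legs of \<open>\<delta>\<close> on the finite spanning set
    \<open>E\<close> of block \<open>i\<close> suffice for the whole block.\<close>
  define W where "W = (\<Union>x\<in>E. V x)"
  have "slice f (lmul (\<delta> y) (c \<otimes>\<^sub>t b)) \<in> cvs.span ((\<lambda>w. lmul w c) ` W)"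
    if f: "clinear f" and "y \<in> cvs.span E" for f y c b
    using that(2)
  proof (induction rule: cvs.span_induct_alt)
    case base
    have "\<delta> 0 = 0" using \<delta>(1)[of 0 0] by simp
    then show ?case by (simp add: slice_0 f cvs.span_zero)
  next
    case (step k x y)
    have "cvs.span ((\<lambda>w. lmul w c) ` V x) \<subseteq> cvs.span ((\<lambda>w. lmul w c) ` W)"
      using step(1) by (intro cvs.span_mono) (auto simp: W_def)
    then have "slice f (lmul (\<delta> x) (c \<otimes>\<^sub>t b)) \<in> cvs.span ((\<lambda>w. lmul w c) ` W)"
      using V(2)[OF f] by blast
    then show ?case
      using step.IH by (simp add: \<delta> slice_add slice_scaleC f cvs.span_add cvs.span_scale)
  qed
  moreover have "finite W" using E(1) V(1) by (simp add: W_def)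
  ultimately show ?thesis using E(2) by blast
qed

text \<open>Surjectivity of the two Galois maps writes the multiplier of any \<open>x\<close> as a
  value of each; applied to a local unit \<open>q \<otimes>\<^sub>t q\<close> of \<open>x\<close>,
  it returns \<open>x\<close> as a sum of products with values of \<open>\<delta>\<close>. This is
  what makes the extension of \<open>\<delta>\<close> to multipliers exist.\<close>

lemma nondegenerate_hom_comult:
  assumes "multiplier_hopf_algebra (\<delta> :: 'a \<Rightarrow> ('a, 'a) tensor multiplier)"
  shows "nondegenerate_hom \<delta>"
  unfolding nondegenerate_hom_def
proof (intro conjI)
  show hom: "algebra_hom \<delta>" using assms by (simp add: multiplier_hopf_algebra_def)
  have surj: "\<exists>s. galois1 \<delta> s = of_alg x" "\<exists>s. galois2 \<delta> s = of_alg x" for x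
    using assms unfolding multiplier_hopf_algebra_def bij_betw_def by (metis rangeI imageE)+
  note g1 = tensor_lift_tens[OF cbilinear_galois1[OF hom], folded galois1_def]
    tensor_lift_rules[OF cbilinear_galois1[OF hom], folded galois1_def]
  note g2 = tensor_lift_tens[OF cbilinear_galois2[OF hom], folded galois2_def]
    tensor_lift_rules[OF cbilinear_galois2[OF hom], folded galois2_def]
  let ?L = "{lmul (\<delta> a) x | a x. True}" and ?R = "{rmul (\<delta> a) x | a x. True}"
  have L: "lmul (galois1 \<delta> s) (q \<otimes>\<^sub>t r) \<in> cvs.span ?L" for s q r
  proof (induction s rule: tensor_induct)
    case (tens a b)
    show ?case by (simp add: g1) (rule cvs.span_base, blast)
  qed (simp add: g1 cvs.span_add)
  have R: "rmul (galois2 \<delta> s) (q \<otimes>\<^sub>t r) \<in> cvs.span ?R" for s q r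
  proof (induction s rule: tensor_induct)
    case (tens a b)
    show ?case by (simp add: g2) (rule cvs.span_base, blast)
  qed (simp add: g2 cvs.span_add)
  have "x \<in> cvs.span ?L \<and> x \<in> cvs.span ?R" for x
  proof -
    obtain q where q: "(q \<otimes>\<^sub>t q) * x = x" "x * (q \<otimes>\<^sub>t q) = x" by (rule tensor_local_unit')
    obtain s t where "galois1 \<delta> s = of_alg x" "galois2 \<delta> t = of_alg x" using surj by blast
    then show ?thesis using L[of s q q] R[of t q q] q by simp
  qed
  then show "cvs.span ?L = UNIV" "cvs.span ?R = UNIV" by blast+
qed

text \<open>A count gives the contradiction: each block in \<open>F\<close> would contribute a
  nonzero vector to one span of at most \<open>card W\<close> vectors, while \<open>F\<close> has
  one block more.\<close>

lemma comult_not_into_tensor: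
  fixes \<delta> :: "'a \<Rightarrow> ('a, 'a) tensor multiplier"
  assumes hopf: "multiplier_hopf_algebra \<delta>" and inf: "infinite I"
  shows "\<not> range \<delta> \<subseteq> range multiplier_embed"
proof
  assume range: "range \<delta> \<subseteq> range multiplier_embed"
  note nd = nondegenerate_tensor
  have hom: "algebra_hom \<delta>" and inj2: "inj (galois2 \<delta>)"
    and surj1: "\<And>x. \<exists>s. galois1 \<delta> s = of_alg x"
    using hopf unfolding multiplier_hopf_algebra_def bij_betw_def by (auto, metis rangeI imageE)
  have lin: "clinear \<delta>" and mult: "\<delta> (a * b) = \<delta> a * \<delta> b" for a b
    using hom by (simp_all add: algebra_hom_def)
  note g1 = tensor_lift_tens[OF cbilinear_galois1[OF hom], folded galois1_def]
    tensor_lift_rules[OF cbilinear_galois1[OF hom], folded galois1_def]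
  note g2 = tensor_lift_tens[OF cbilinear_galois2[OF hom], folded galois2_def]
    tensor_lift_rules[OF cbilinear_galois2[OF hom], folded galois2_def]
  obtain i where i: "i \<in> I" using inf by (metis ex_in_conv finite.emptyI)
  obtain W where W: "finite W" "\<And>f a b c. clinear f \<Longrightarrow>
      slice f (lmul (\<delta> (e i * a)) (c \<otimes>\<^sub>t b)) \<in> cvs.span ((\<lambda>w. lmul w c) ` W)"
    using block_slices[OF lin _ i] range by blast
  obtain F where F: "finite F" "F \<subseteq> I" "card F = Suc (card W)"
    using inf by (metis infinite_arbitrarily_large)
  \<comment> \<open>The members of \<open>W\<close> are applied to \<open>sum e F\<close> instead of
    \<open>e j\<close>, so that one span serves all \<open>j\<close> in \<open>F\<close>.\<close>
  have slices: "slice f (lmul (\<delta> (e i)) (e j \<otimes>\<^sub>t b)) \<in> cvs.span ((\<lambda>w. lmul w (sum e F)) ` W)"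
    if f: "clinear f" and j: "j \<in> F" for f j b
  proof -
    obtain H where H: "H \<subseteq> I" "sum e H * b = b" using local_unit by blast
    obtain s where s: "galois1 \<delta> s = of_alg (e j \<otimes>\<^sub>t b)" using surj1 by blast
    \<comment> \<open>The chosen \<open>s\<close> represents \<open>e j \<otimes>\<^sub>t b\<close>,
      which is fixed by right multiplication with \<open>sum e F \<otimes>\<^sub>t sum e H\<close>.
      On elementary tensors, \<open>\<delta> (e i) * \<delta> a = \<delta> (e i * a)\<close> brings
      the slices under the bound given by \<open>W\<close>.\<close>
    have "slice f (lmul (\<delta> (e i)) (lmul (galois1 \<delta> s) (sum e F \<otimes>\<^sub>t sum e H)))
        \<in> cvs.span ((\<lambda>w. lmul w (sum e F)) ` W)"
    proof (induction s rule: tensor_induct)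
      case (tens a b)
      have "slice f (lmul (\<delta> (e i * a)) (sum e F \<otimes>\<^sub>t (b * sum e H)))
          \<in> cvs.span ((\<lambda>w. lmul w (sum e F)) ` W)"
        by (rule W(2)[OF f])
      then show ?case by (simp add: g1 mult)
    qed (simp add: g1 lmul_rules slice_add f cvs.span_add)
    then show ?thesis
      using mult_sum[OF F(1,2) j] H sum_central[OF H(1)] by (simp add: s tens_mult)
  qed
  have "\<exists>z. z \<in> cvs.span ((\<lambda>w. lmul w (sum e F)) ` W) \<and> e j * z = z \<and> z \<noteq> 0" if j: "j \<in> F" for j
  proof -
    have jI: "j \<in> I" using F j by blast
    let ?Z = "multiplier_tens (of_alg (e j)) 1 :: ('a, 'a) tensor multiplier"
    have comm: "?Z * \<delta> (e i) = \<delta> (e i) * ?Z"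
      by (rule central_tens_commute[OF nd central[OF jI]])
    \<comment> \<open>Otherwise \<open>\<delta> (e i) * ?Z\<close> is 0. By centrality of
      \<open>?Z\<close> it equals \<open>galois2 \<delta> (e j \<otimes>\<^sub>t e i)\<close>, which
      is nonzero by injectivity.\<close>
    have "\<exists>b. lmul (\<delta> (e i)) (e j \<otimes>\<^sub>t b) \<noteq> 0"
    proof (rule ccontr)
      assume "\<nexists>b. lmul (\<delta> (e i)) (e j \<otimes>\<^sub>t b) \<noteq> 0"
      then have 0: "lmul (\<delta> (e i)) (e j \<otimes>\<^sub>t b) = 0" for b by blast
      have "lmul (\<delta> (e i) * ?Z) x = 0" for x
      proof (induction x rule: tensor_induct)
        case (tens a b)
        obtain H where H: "H \<subseteq> I" "sum e H * b = b" using local_unit by blast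
        \<comment> \<open>The local unit of \<open>b\<close> splits off a right factor, which
          \<open>lmul_mult\<close> takes out of the multiplier.\<close>
        have "(e j * a) \<otimes>\<^sub>t b = (e j \<otimes>\<^sub>t b) * (a \<otimes>\<^sub>t sum e H)"
          using H sum_central[OF H(1)] by (simp add: tens_mult)
        then show ?case using lmul_mult[OF nd, of "\<delta> (e i)" "e j \<otimes>\<^sub>t b"] 0 by simp
      next
        case (add x y)
        then show ?case by (simp add: lmul_rules)
      qed
      then have "\<delta> (e i) * ?Z = 0" by (intro multiplier_eq_left[OF nd]) simp
      then have "galois2 \<delta> (e j \<otimes>\<^sub>t e i) = 0" by (simp add: g2 comm)
      moreover have "galois2 \<delta> 0 = 0" using g2(2)[of 0 0] by simp
      ultimately have "e j \<otimes>\<^sub>t e i = 0" using inj2 by (metis injD)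
      then show False using tens_nonzero nonzero i jI by blast
    qed
    then obtain b f where f: "clinear f" and nz: "slice f (lmul (\<delta> (e i)) (e j \<otimes>\<^sub>t b)) \<noteq> 0"
      using slices_separate by blast
    let ?t = "lmul (\<delta> (e i)) (e j \<otimes>\<^sub>t b)"
    \<comment> \<open>Commuting \<open>?Z\<close> past \<open>\<delta> (e i)\<close> lets it act on
      \<open>e j\<close>, where it is absorbed. Since slicing the second leg respects multiplication
      on the first, the slice then lies in block \<open>j\<close>.\<close>
    have "lmul ?Z ?t = lmul (\<delta> (e i) * ?Z) (e j \<otimes>\<^sub>t b)" by (simp flip: comm)
    then have Zt: "lmul ?Z ?t = ?t" by (simp add: idem[OF jI])
    have "slice f (lmul ?Z x) = e j * slice f x" for x
      by (induction x rule: tensor_induct)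
         (simp_all add: slice_tens slice_add f lmul_rules distrib_left mult_scaleC_right)
    from this[of ?t] have "e j * slice f ?t = slice f ?t" by (simp add: Zt)
    then show ?thesis using slices[OF f j] nz by blast
  qed
  then obtain z where "\<And>j. j \<in> F \<Longrightarrow> z j \<in> cvs.span ((\<lambda>w. lmul w (sum e F)) ` W)"
    "\<And>j. j \<in> F \<Longrightarrow> e j * z j = z j" "\<And>j. j \<in> F \<Longrightarrow> z j \<noteq> 0"
    by metis
  then have "card F \<le> card ((\<lambda>w. lmul w (sum e F)) ` W)"
    using F W by (intro card_blocks_le) auto
  also have "\<dots> \<le> card W" using W(1) by (rule card_image_le)
  finally show False using F(3) by simp
qed

end

section \<open>Matrix direct sums as block decompositions\<close>

lemma block_decomposition_exists:
  fixes I :: "'i set"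
  assumes "is_matrix_direct_sum TYPE('a::complex_algebra) I n"
  shows "\<exists>e :: 'i \<Rightarrow> 'a. block_decomposition I e"
proof -
  from assms have n: "0 < n i" if "i \<in> I" for i
    using that by (simp add: is_matrix_direct_sum_def)
  from assms obtain \<phi> :: "'a \<Rightarrow> 'i \<Rightarrow> complex mat"
    where bij: "bij_betw \<phi> UNIV (matrix_direct_sum I n)"
      and \<phi>: "\<forall>i\<in>I. \<forall>a b. \<phi> (a + b) i = \<phi> a i + \<phi> b i"
        "\<forall>i\<in>I. \<forall>c a. \<phi> (c *\<^sub>C a) i = c \<cdot>\<^sub>m \<phi> a i"
        "\<forall>i\<in>I. \<forall>a b. \<phi> (a * b) i = \<phi> a i * \<phi> b i"
    unfolding is_matrix_direct_sum_def by (elim conjE exE)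
  from \<phi> have add: "\<phi> (a + b) i = \<phi> a i + \<phi> b i"
    and scale: "\<phi> (c *\<^sub>C a) i = c \<cdot>\<^sub>m \<phi> a i"
    and mult: "\<phi> (a * b) i = \<phi> a i * \<phi> b i" if "i \<in> I" for i a b c
    using that by blast+
  have mem: "\<phi> a \<in> matrix_direct_sum I n" for a
    using bij by (auto simp: bij_betw_def)
  have carrier: "\<phi> a i \<in> carrier_mat (n i) (n i)" if "i \<in> I" for a i
    using mem[of a] that by (auto simp: matrix_direct_sum_def PiE_def Pi_def)
  have eqI: "a = b" if "\<And>i. i \<in> I \<Longrightarrow> \<phi> a i = \<phi> b i" for a b
  proof -
    have "\<phi> a = \<phi> b"
      using mem[of a] mem[of b] that unfolding matrix_direct_sum_def by (blast intro: PiE_ext)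
    then show ?thesis using bij by (auto simp: bij_betw_def inj_eq)
  qed
  have zero: "\<phi> 0 i = 0\<^sub>m (n i) (n i)" if "i \<in> I" for i
  proof -
    have "0 \<cdot>\<^sub>m \<phi> 0 i = 0\<^sub>m (n i) (n i)"
      using carrier[OF that, of 0] by (intro eq_matI) auto
    then show ?thesis using scale[OF that, of 0 0] by simp
  qed
  \<comment> \<open>A family supported at a single index belongs to the direct sum, so surjectivity
    of \<open>\<phi>\<close> supplies a preimage.\<close>
  have single: "\<exists>a. \<forall>j\<in>I. \<phi> a j = (if j = i then M else 0\<^sub>m (n j) (n j))"
    if "M \<in> carrier_mat (n i) (n i)" for i M
  proof -
    define f where "f = (\<lambda>j\<in>I. if j = i then M else 0\<^sub>m (n j) (n j))"
    have "{j \<in> I. f j \<noteq> 0\<^sub>m (n j) (n j)} \<subseteq> {i}" by (auto simp: f_def)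
    then have "finite {j \<in> I. f j \<noteq> 0\<^sub>m (n j) (n j)}" by (rule finite_subset) simp
    then have "f \<in> matrix_direct_sum I n"
      using that by (auto simp: matrix_direct_sum_def f_def)
    then obtain a where "\<phi> a = f" using bij by (metis bij_betw_def imageE)
    then show ?thesis by (intro exI[of _ a]) (auto simp: f_def)
  qed
  define u where "u i M = (SOME a. \<forall>j\<in>I. \<phi> a j = (if j = i then M else 0\<^sub>m (n j) (n j)))" for i M
  have u: "\<phi> (u i M) j = (if j = i then M else 0\<^sub>m (n j) (n j))"
    if "M \<in> carrier_mat (n i) (n i)" "j \<in> I" for i M j
    using someI_ex[OF single[OF that(1)], folded u_def] that(2) by blast
  define e where "e i = u i (1\<^sub>m (n i))" for i
  have e: "\<phi> (e i) j = (if j = i then 1\<^sub>m (n j) else 0\<^sub>m (n j) (n j))" if "j \<in> I" for i j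
    using that by (simp add: e_def u)
  have left: "\<phi> (e i * a) j = (if j = i then \<phi> a j else 0\<^sub>m (n j) (n j))"
    and right: "\<phi> (a * e i) j = (if j = i then \<phi> a j else 0\<^sub>m (n j) (n j))" if "j \<in> I" for i j a
    using carrier[OF that, of a] that by (auto simp: e mult)
  have "block_decomposition I e"
  proof
    fix i j a
    show "e i * a = a * e i" by (rule eqI) (auto simp: left right)
    show "e i * e i = e i" by (rule eqI) (auto simp: left e)
    show "e i * e j = 0" if "i \<noteq> j" by (rule eqI) (use that in \<open>auto simp: left e zero\<close>)
    show "e i \<noteq> 0" if i: "i \<in> I"
    proof
      assume "e i = 0"
      \<comment> \<open>Positive block size makes (0, 0) a valid entry, and there the identity and
        zero matrices differ.\<close>
      then have "1\<^sub>m (n i) $$ (0, 0) = (0\<^sub>m (n i) (n i) $$ (0, 0) :: complex)"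
        using e[OF i, of i] zero[OF i] by simp
      then show False using n[OF i] by simp
    qed
    show "\<exists>F. finite F \<and> F \<subseteq> I \<and> sum e F * a = a"
    proof (intro exI conjI)
      \<comment> \<open>The support of \<open>a\<close>: outside it both sides vanish, and on it the
        sum of idempotents acts as the identity matrix.\<close>
      let ?F = "{i \<in> I. \<phi> a i \<noteq> 0\<^sub>m (n i) (n i)}"
      show F: "finite ?F" using mem[of a] by (simp add: matrix_direct_sum_def)
      show "?F \<subseteq> I" by blast
      have sum: "\<phi> (sum e G) j = (if j \<in> G then 1\<^sub>m (n j) else 0\<^sub>m (n j) (n j))"
        if "finite G" "j \<in> I" for G j
        using that by (induction G rule: finite_induct) (auto simp: zero add e)
      show "sum e ?F * a = a"
        by (rule eqI) (auto simp: mult sum[OF F] left_mult_one_mat[OF carrier])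
    qed
    show "\<exists>E. finite E \<and> (\<forall>a. e i * a \<in> cvs.span E)" if i: "i \<in> I"
    proof -
      \<comment> \<open>These are the matrix units of block \<open>i\<close>, indexed by pairs
        \<open>k\<close>. The coefficients of \<open>e i * a\<close> in them are the entries of
        \<open>\<phi> a i\<close>.\<close>
      define U where "U k = u i (mat (n i) (n i) (\<lambda>l. if l = k then 1 else 0))" for k
      let ?S = "{..<n i} \<times> {..<n i}"
      have U: "\<phi> (U k) j = (if j = i then mat (n i) (n i) (\<lambda>l. if l = k then 1 else 0) else 0\<^sub>m (n j) (n j))"
        if "j \<in> I" for k j
        using that by (simp add: U_def u)
      have sum: "\<phi> (\<Sum>k\<in>S. c k *\<^sub>C U k) j = mat (n j) (n j) (\<lambda>l. \<Sum>k\<in>S. c k * \<phi> (U k) j $$ l)"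
        if "finite S" "j \<in> I" for S c j
        using that
      proof (induction S rule: finite_induct)
        case (insert k S)
        have "\<phi> (U k) j \<in> carrier_mat (n j) (n j)" by (rule carrier) fact
        with insert show ?case by (intro eq_matI) (auto simp: add scale)
      qed (auto simp: zero intro!: eq_matI)
      have "e i * a = (\<Sum>k\<in>?S. \<phi> a i $$ k *\<^sub>C U k)" for a
      proof (rule eqI)
        fix j assume j: "j \<in> I"
        show "\<phi> (e i * a) j = \<phi> (\<Sum>k\<in>?S. \<phi> a i $$ k *\<^sub>C U k) j"
          unfolding sum[OF finite_cartesian_product[OF finite_lessThan finite_lessThan] j] left[OF j]
        proof (rule eq_matI)
          fix r s
          assume rs: "r < dim_row (mat (n j) (n j) (\<lambda>l. \<Sum>k\<in>?S. \<phi> a i $$ k * \<phi> (U k) j $$ l))"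
            "s < dim_col (mat (n j) (n j) (\<lambda>l. \<Sum>k\<in>?S. \<phi> a i $$ k * \<phi> (U k) j $$ l))"
          have "(\<Sum>k\<in>?S. \<phi> a i $$ k * (if (r, s) = k then 1 else 0)) = \<phi> a i $$ (r, s)" if "j = i"
            using rs that by (simp add: if_distrib[of "(*) _"] sum.delta' cong: if_cong)
          then show "(if j = i then \<phi> a j else 0\<^sub>m (n j) (n j)) $$ (r, s) =
              mat (n j) (n j) (\<lambda>l. \<Sum>k\<in>?S. \<phi> a i $$ k * \<phi> (U k) j $$ l) $$ (r, s)"
            using rs by (auto simp: U[OF j])
        qed (use carrier[OF j, of a] in auto)
      qed
      then have "e i * a \<in> cvs.span (U ` ?S)" for a
        by (simp only:) (rule cvs.span_sum, rule cvs.span_scale, rule cvs.span_base, rule imageI)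
      then show ?thesis by (intro exI[of _ "U ` ?S"]) auto
    qed
  qed
  then show ?thesis by blast
qed

text \<open>The extension restricts to \<open>\<delta>\<close> on the algebra, so a Hopf structure
  would place every \<open>\<delta> a\<close> in the range of \<open>multiplier_embed\<close>,
  contrary to \<open>comult_not_into_tensor\<close>.\<close>

theorem corollary4p8:
  fixes \<delta> :: "'a::complex_star_algebra \<Rightarrow> ('a, 'a) tensor multiplier"
    and I :: "'i set" and n :: "'i \<Rightarrow> nat"
  assumes "discrete_quantum_group \<delta> I n"
    and "\<not> finite_dimensional TYPE('a)"
  shows "\<not> multiplier_algebra_is_hopf (multiplier_extension \<delta>)"
proof
  assume "multiplier_algebra_is_hopf (multiplier_extension \<delta>)"
  then obtain \<Delta> where \<Delta>: "\<And>m. multiplier_extension \<delta> m = multiplier_embed (\<Delta> m)"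
    unfolding multiplier_algebra_is_hopf_def by blast
  have hopf: "multiplier_hopf_algebra \<delta>" and sum: "is_matrix_direct_sum TYPE('a) I n"
    using assms(1) by (simp_all add: discrete_quantum_group_def multiplier_hopf_star_algebra_def)
  then obtain e :: "'i \<Rightarrow> 'a" where "block_decomposition I e"
    using block_decomposition_exists by blast
  then interpret block_decomposition I e .
  have "nondegenerate_product TYPE('a)" using hopf by (simp add: multiplier_hopf_algebra_def)
  \<comment> \<open>\<open>multiplier_extension\<close> is a definite description, so existence and
    uniqueness must come before its agreement with \<open>\<delta>\<close> can be used.\<close>
  then have "\<exists>!\<Psi>. is_multiplier_extension \<delta> \<Psi>"
    using nondegenerate_tensor nondegenerate_hom_comult[OF hopf] by (rule multiplier_extension_exists)
  from theI'[OF this] have "is_multiplier_extension \<delta> (multiplier_extension \<delta>)"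
    unfolding multiplier_extension_def .
  then have "\<delta> a = multiplier_embed (\<Delta> (of_alg a))" for a
    using \<Delta> by (simp add: is_multiplier_extension_def)
  moreover have "infinite I" using finite_dimensional_if_finite assms(2) by blast
  ultimately show False using comult_not_into_tensor[OF hopf] by blast
qed

end
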